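(* The variety $\mathsf V(S_7)$ has exactly $6$ finitely based subvarieties, namely the trivial variety $\mathbf T$, $\mathsf V(M_2)$, $\mathsf V(S_c(a))$, $\mathsf V(S_c(ab))$, $\mathsf V(M_2,S_c(a))$ and $\mathsf V(M_2,S_c(ab))$; all other subvarieties of $\mathsf V(S_7)$ are nonfinitely based.
   Context: A variety is finitely based if it can be defined by finitely many identities. $S_7$ is the ai-semiring on $\{\infty,a,1\}$ with $x+x=x$, $x+y=\infty$ for $x\neq y$, and commutative multiplication with $\infty$ a zero, $a\cdot a=\infty$, $a\cdot 1=a$, $1\cdot1=1$. All of the following are flat semirings (flat addition $x+x=x$, $x+y=\infty$ for $x\ne y$; $\infty$ a multiplicative zero): $M_2=\{1,\infty\}$ with $1\cdot1=1$; $S_c(a)=\{a,\infty\}$ with $a\cdot a=\infty$; $S_c(ab)=\{a,b,ab,\infty\}$ with $a\cdot b=b\cdot a=ab$ and all other products $\infty$. $\mathsf V(K)$ denotes the variety generated by the algebras in $K$. *)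

theory Defs
  imports Main
begin

datatype trm = Var nat | Pl trm trm | Tm trm trm

type_synonym identity = "trm \<times> trm"

fun subst :: "(nat \<Rightarrow> trm) \<Rightarrow> trm \<Rightarrow> trm" where
  "subst f (Var i) = f i"
| "subst f (Pl s t) = Pl (subst f s) (subst f t)"
| "subst f (Tm s t) = Tm (subst f s) (subst f t)"

inductive_set Cn :: "identity set \<Rightarrow> identity set" for \<Sigma> :: "identity set" where
  base: "p \<in> \<Sigma> \<Longrightarrow> p \<in> Cn \<Sigma>"
| refl: "(t, t) \<in> Cn \<Sigma>"
| sym: "(s, t) \<in> Cn \<Sigma> \<Longrightarrow> (t, s) \<in> Cn \<Sigma>"
| trans: "(s, t) \<in> Cn \<Sigma> \<Longrightarrow> (t, u) \<in> Cn \<Sigma> \<Longrightarrow> (s, u) \<in> Cn \<Sigma>"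
| cong_pl: "(s, t) \<in> Cn \<Sigma> \<Longrightarrow> (s', t') \<in> Cn \<Sigma> \<Longrightarrow> (Pl s s', Pl t t') \<in> Cn \<Sigma>"
| cong_tm: "(s, t) \<in> Cn \<Sigma> \<Longrightarrow> (s', t') \<in> Cn \<Sigma> \<Longrightarrow> (Tm s s', Tm t t') \<in> Cn \<Sigma>"
| subst: "(s, t) \<in> Cn \<Sigma> \<Longrightarrow> (subst f s, subst f t) \<in> Cn \<Sigma>"

text \<open>An equational theory (= the identities of a variety).\<close>
definition eq_theory :: "identity set \<Rightarrow> bool" where
  "eq_theory T \<longleftrightarrow> Cn T = T"

definition finitely_based :: "identity set \<Rightarrow> bool" where
  "finitely_based T \<longleftrightarrow> (\<exists>\<Sigma>. finite \<Sigma> \<and> Cn \<Sigma> = T)"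

datatype el = Inf | A | B | AB | One

definition fadd :: "el \<Rightarrow> el \<Rightarrow> el" where
  "fadd x y = (if x = y then x else Inf)"

fun eval :: "(el \<Rightarrow> el \<Rightarrow> el) \<Rightarrow> (nat \<Rightarrow> el) \<Rightarrow> trm \<Rightarrow> el" where
  "eval m \<sigma> (Var i) = \<sigma> i"
| "eval m \<sigma> (Pl s t) = fadd (eval m \<sigma> s) (eval m \<sigma> t)"
| "eval m \<sigma> (Tm s t) = m (eval m \<sigma> s) (eval m \<sigma> t)"

definition Id_alg :: "el set \<Rightarrow> (el \<Rightarrow> el \<Rightarrow> el) \<Rightarrow> identity set" where
  "Id_alg C m = {(s, t). \<forall>\<sigma>. (\<forall>i. \<sigma> i \<in> C) \<longrightarrow> eval m \<sigma> s = eval m \<sigma> t}"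

fun mul7 :: "el \<Rightarrow> el \<Rightarrow> el" where
  "mul7 A One = A" | "mul7 One A = A" | "mul7 One One = One" | "mul7 _ _ = Inf"

fun mulM2 :: "el \<Rightarrow> el \<Rightarrow> el" where
  "mulM2 One One = One" | "mulM2 _ _ = Inf"

definition mulSa :: "el \<Rightarrow> el \<Rightarrow> el" where
  "mulSa x y = Inf"

fun mulSab :: "el \<Rightarrow> el \<Rightarrow> el" where
  "mulSab A B = AB" | "mulSab B A = AB" | "mulSab _ _ = Inf"

definition Id_S7 :: "identity set" where "Id_S7 = Id_alg {Inf, A, One} mul7"
definition Id_M2 :: "identity set" where "Id_M2 = Id_alg {One, Inf} mulM2"
definition Id_Sca :: "identity set" where "Id_Sca = Id_alg {A, Inf} mulSa"
definition Id_Scab :: "identity set" where "Id_Scab = Id_alg {A, B, AB, Inf} mulSab"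

end

theory Submission
  imports Defs
begin

text \<open>Write \<open>IdS k\<close> for the identities of \<open>S\<^sub>c(x\<^sub>0\<dots>x\<^bsub>k-1\<^esub>)\<close>, a member of the variety of S7 whose
  nonzero elements are the nonempty subwords of a linear word. If an equational theory \<open>T\<close>
  containing the identities of S7 is not included in \<open>IdS k\<close>, then it contains
  \<open>x\<^sub>0\<dots>x\<^bsub>k-1\<^esub> \<approx> (x\<^sub>0\<dots>x\<^bsub>k-1\<^esub>)\<^sup>2\<close>, and if it is not included in the theory of \<open>M\<^sub>2\<close>, then it
  contains \<open>x\<^sup>2 \<approx> y\<^sup>2\<close>. If \<open>T\<close> is not included in \<open>IdS 3\<close>, these identities and finitely many
  identities of S7 determine \<open>T\<close>: a term without square summands is essentially a graph, its
  nonzero values in \<open>S\<^sub>c(ab)\<close> are proper 2-colourings, and \<open>T\<close> absorbs every edge that all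
  2-colourings respect.

  If \<open>T\<close> is included in \<open>IdS 3\<close>, it has no finite basis. A 3-uniform hypergraph of large girth
  gives a flat algebra in which every identity of \<open>IdS 3\<close> in few variables holds, because an
  acyclic hypergraph has many rainbow 3-colourings. If the hypergraph is 3-regular and the number
  of its vertices is not a multiple of 3, then \<open>t \<approx> t\<^sup>2\<close> for the sum \<open>t\<close> of its hyperedges is an
  identity of S7 that fails in this algebra.\<close>

section \<open>Identities of algebras\<close>

text \<open>The threshold lies between words of length two and three because pairwise constraints
  propagate locally. All that 2-colourings of a graph imply about edges is generated by one rule, a
  walk of three edges closing to an edge, so one axiom captures it. For hyperedges of size three,
  counting modulo 3 over the whole hypergraph has consequences that no bounded number of variables
  can see.

  M2 sees only which variables occur, and this is also all that survives in a square. A theory not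
  included in \<open>IdS 3\<close> is therefore located by two data: the largest \<open>k\<close>
  with \<open>T \<subseteq> IdS k\<close>, which is 0, 1 or 2, and whether it is included in
  \<open>Id_M2\<close>. This accounts for the number six.

  Three involutions on one set make the hypergraph 3-uniform and 3-regular by construction. Large
  girth comes from iterated lifts of a single point; each lift multiplies the size by a power of 2,
  so indivisibility by 3 survives at every girth.\<close>

primrec ev :: "('a \<Rightarrow> 'a \<Rightarrow> 'a) \<Rightarrow> ('a \<Rightarrow> 'a \<Rightarrow> 'a) \<Rightarrow> (nat \<Rightarrow> 'a) \<Rightarrow> trm \<Rightarrow> 'a" where
  "ev p m \<sigma> (Var i) = \<sigma> i"
| "ev p m \<sigma> (Pl s t) = p (ev p m \<sigma> s) (ev p m \<sigma> t)"
| "ev p m \<sigma> (Tm s t) = m (ev p m \<sigma> s) (ev p m \<sigma> t)"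

primrec vars :: "trm \<Rightarrow> nat set" where
  "vars (Var i) = {i}"
| "vars (Pl s t) = vars s \<union> vars t"
| "vars (Tm s t) = vars s \<union> vars t"

text \<open>\<open>eval\<close> is tied to \<open>el\<close> and \<open>fadd\<close>; the algebras
  of subsets and of hypergraphs need other types and additions.\<close>

definition Ids :: "'a set \<Rightarrow> ('a \<Rightarrow> 'a \<Rightarrow> 'a) \<Rightarrow> ('a \<Rightarrow> 'a \<Rightarrow> 'a) \<Rightarrow> identity set" where
  "Ids C p m = {(s, t). \<forall>\<sigma>. (\<forall>i. \<sigma> i \<in> C) \<longrightarrow> ev p m \<sigma> s = ev p m \<sigma> t}"

lemma IdsI:
  assumes "\<And>\<sigma>. (\<forall>i. \<sigma> i \<in> C) \<Longrightarrow> ev p m \<sigma> s = ev p m \<sigma> t"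
  shows "(s, t) \<in> Ids C p m"
  using assms by (auto simp: Ids_def)

lemma IdsD:
  assumes "(s, t) \<in> Ids C p m" and "\<And>i. \<sigma> i \<in> C"
  shows "ev p m \<sigma> s = ev p m \<sigma> t"
  using assms by (auto simp: Ids_def)

lemma finite_vars [simp]: "finite (vars t)"
  by (induction t) auto

lemma ev_subst: "ev p m \<sigma> (subst f t) = ev p m (\<lambda>i. ev p m \<sigma> (f i)) t"
  by (induction t) auto

lemma ev_cong: "(\<And>i. i \<in> vars t \<Longrightarrow> \<sigma> i = \<tau> i) \<Longrightarrow> ev p m \<sigma> t = ev p m \<tau> t"
proof (induction t)
  case (Pl s t)
  from Pl.IH Pl.prems show ?case by simp
next
  case (Tm s t)
  from Tm.IH Tm.prems show ?case by simp
qed simp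

lemma vars_subst: "vars (subst f t) = (\<Union>i\<in>vars t. vars (f i))"
  by (induction t) auto

lemma ev_closed:
  assumes "\<And>x y. x \<in> C \<Longrightarrow> y \<in> C \<Longrightarrow> p x y \<in> C"
    and "\<And>x y. x \<in> C \<Longrightarrow> y \<in> C \<Longrightarrow> m x y \<in> C"
    and "\<And>i. \<sigma> i \<in> C"
  shows "ev p m \<sigma> t \<in> C"
  by (induction t) (auto intro: assms)

lemma Cn_subset_Ids:
  fixes C :: "'a set"
  assumes "\<And>x y. x \<in> C \<Longrightarrow> y \<in> C \<Longrightarrow> p x y \<in> C"
    and "\<And>x y. x \<in> C \<Longrightarrow> y \<in> C \<Longrightarrow> m x y \<in> C"
    and "\<Sigma> \<subseteq> Ids C p m"
  shows "Cn \<Sigma> \<subseteq> Ids C p m"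
proof (rule subrelI)
  fix s t assume "(s, t) \<in> Cn \<Sigma>"
  then show "(s, t) \<in> Ids C p m"
  proof (induction "(s, t)" arbitrary: s t rule: Cn.induct)
    case (base s t)
    then show ?case using assms(3) by auto
  next
    case (subst s t f)
    show ?case
    proof (rule IdsI)
      fix \<sigma> :: "nat \<Rightarrow> 'a" assume "\<forall>i. \<sigma> i \<in> C"
      then have "\<And>i. ev p m \<sigma> (f i) \<in> C"
        using ev_closed[of C p m \<sigma>] assms(1,2) by blast
      from IdsD[OF subst(2) this]
      show "ev p m \<sigma> (Defs.subst f s) = ev p m \<sigma> (Defs.subst f t)"
        by (simp add: ev_subst)
    qed
  qed (auto simp: Ids_def)
qed

lemma eq_theory_Ids:
  assumes "\<And>x y. x \<in> C \<Longrightarrow> y \<in> C \<Longrightarrow> p x y \<in> C"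
    and "\<And>x y. x \<in> C \<Longrightarrow> y \<in> C \<Longrightarrow> m x y \<in> C"
  shows "eq_theory (Ids C p m)"
  unfolding eq_theory_def
proof
  show "Cn (Ids C p m) \<subseteq> Ids C p m"
    by (rule Cn_subset_Ids) (auto intro: assms)
  show "Ids C p m \<subseteq> Cn (Ids C p m)"
    by (auto intro: Cn.base)
qed

lemma
  assumes "eq_theory T"
  shows eq_theory_refl: "(t, t) \<in> T"
    and eq_theory_sym: "(s, t) \<in> T \<Longrightarrow> (t, s) \<in> T"
    and eq_theory_trans: "(s, t) \<in> T \<Longrightarrow> (t, u) \<in> T \<Longrightarrow> (s, u) \<in> T"
    and eq_theory_Pl: "(s, t) \<in> T \<Longrightarrow> (s', t') \<in> T \<Longrightarrow> (Pl s s', Pl t t') \<in> T"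
    and eq_theory_Tm: "(s, t) \<in> T \<Longrightarrow> (s', t') \<in> T \<Longrightarrow> (Tm s s', Tm t t') \<in> T"
    and eq_theory_subst: "(s, t) \<in> T \<Longrightarrow> (subst f s, subst f t) \<in> T"
proof -
  have T: "Cn T = T" using assms by (simp add: eq_theory_def)
  show "(t, t) \<in> T" using Cn.refl[of t T] T by simp
  show "(s, t) \<in> T \<Longrightarrow> (t, s) \<in> T" using Cn.sym[of s t T] T by simp
  show "(s, t) \<in> T \<Longrightarrow> (t, u) \<in> T \<Longrightarrow> (s, u) \<in> T" using Cn.trans[of s t T u] T by simp
  show "(s, t) \<in> T \<Longrightarrow> (s', t') \<in> T \<Longrightarrow> (Pl s s', Pl t t') \<in> T"
    using Cn.cong_pl[of s t T s' t'] T by simp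
  show "(s, t) \<in> T \<Longrightarrow> (s', t') \<in> T \<Longrightarrow> (Tm s s', Tm t t') \<in> T"
    using Cn.cong_tm[of s t T s' t'] T by simp
  show "(s, t) \<in> T \<Longrightarrow> (subst f s, subst f t) \<in> T"
    using Cn.subst[of s t T f] T by simp
qed

lemma eq_theory_Cn: "eq_theory (Cn \<Sigma>)"
proof -
  have "(s, t) \<in> Cn \<Sigma>" if "(s, t) \<in> Cn (Cn \<Sigma>)" for s t
    using that
    by (induction "(s, t)" arbitrary: s t rule: Cn.induct) (auto intro: Cn.intros)
  then show ?thesis
    unfolding eq_theory_def by (auto intro: Cn.base)
qed

lemma Cn_least: "eq_theory T \<Longrightarrow> \<Sigma> \<subseteq> T \<Longrightarrow> Cn \<Sigma> \<subseteq> T"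
proof (rule subrelI)
  fix s t
  assume T: "eq_theory T" "\<Sigma> \<subseteq> T" and "(s, t) \<in> Cn \<Sigma>"
  from this(3) show "(s, t) \<in> T"
  proof (induction "(s, t)" arbitrary: s t rule: Cn.induct)
    case base
    then show ?case using T(2) by blast
  next
    case sym
    from eq_theory_sym[OF T(1) sym(2)] show ?case .
  next
    case trans
    from eq_theory_trans[OF T(1) trans(2,4)] show ?case .
  next
    case cong_pl
    from eq_theory_Pl[OF T(1) cong_pl(2,4)] show ?case .
  next
    case cong_tm
    from eq_theory_Tm[OF T(1) cong_tm(2,4)] show ?case .
  next
    case subst
    from eq_theory_subst[OF T(1) subst(2)] show ?case .
  qed (rule eq_theory_refl[OF T(1)])
qed

lemma eq_theory_Int:
  assumes "eq_theory S" and "eq_theory T"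
  shows "eq_theory (S \<inter> T)"
  unfolding eq_theory_def
proof
  show "Cn (S \<inter> T) \<subseteq> S \<inter> T"
    using Cn_least[OF assms(1), of "S \<inter> T"] Cn_least[OF assms(2), of "S \<inter> T"] by simp
  show "S \<inter> T \<subseteq> Cn (S \<inter> T)"
    by (auto intro: Cn.base)
qed

lemma Id_alg_eq_Ids: "Id_alg C m = Ids C fadd m"
proof -
  have "eval m \<sigma> t = ev fadd m \<sigma> t" for \<sigma> t
    by (induction t) auto
  then show ?thesis by (simp add: Id_alg_def Ids_def)
qed

section \<open>The semiring S7 and the semirings of subwords of a linear word\<close>

text \<open>The multiplication of S7, extended to the junk elements of \<^typ>\<open>el\<close> in such a
  way that it is a commutative monoid on the whole type.\<close>
definition mulS :: "el \<Rightarrow> el \<Rightarrow> el" where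
  "mulS x y = (if x = One then y else if y = One then x else Inf)"

lemma fadd_idem [simp]: "fadd x x = x"
  by (simp add: fadd_def)

lemma fadd_neq: "x \<noteq> y \<Longrightarrow> fadd x y = Inf"
  by (simp add: fadd_def)

lemma mulS_noninf: "mulS x y \<noteq> Inf \<Longrightarrow> x \<noteq> Inf \<and> y \<noteq> Inf"
  by (auto simp: mulS_def split: if_splits)

abbreviation "ev7 \<equiv> ev fadd mulS"
abbreviation "car7 \<equiv> {Inf, A, One}"

lemma ev7_in: "(\<And>i. \<sigma> i \<in> car7) \<Longrightarrow> ev7 \<sigma> t \<in> car7"
  by (rule ev_closed) (auto simp: fadd_def mulS_def)

lemma Id_S7_eq: "Id_S7 = Ids car7 fadd mulS"
proof -
  have m: "mul7 x y = mulS x y" if "x \<in> car7" "y \<in> car7" for x y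
    using that by (auto simp: mulS_def)
  have "ev fadd mul7 \<sigma> t = ev7 \<sigma> t" if "\<And>i. \<sigma> i \<in> car7" for \<sigma> t
    using ev7_in[OF that] by (induction t) (auto simp: m)
  then show ?thesis by (auto simp: Id_S7_def Id_alg_eq_Ids Ids_def)
qed

lemma eq_theory_Id_S7: "eq_theory Id_S7"
  unfolding Id_S7_eq by (rule eq_theory_Ids) (auto simp: fadd_def mulS_def)

lemma Id_S7I: "(\<And>\<sigma>. (\<forall>i. \<sigma> i \<in> car7) \<Longrightarrow> ev7 \<sigma> s = ev7 \<sigma> t) \<Longrightarrow> (s, t) \<in> Id_S7"
  unfolding Id_S7_eq by (rule IdsI)

text \<open>The nonzero elements of \<open>S\<^sub>c(x\<^sub>0\<dots>x\<^bsub>k-1\<^esub>)\<close> are encoded as the nonempty subsets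
  of \<open>{..<k}\<close>, and \<open>\<infinity>\<close> as the empty set.\<close>
definition dadd :: "nat set \<Rightarrow> nat set \<Rightarrow> nat set" where
  "dadd X Y = (if X = Y then X else {})"

definition dmul :: "nat set \<Rightarrow> nat set \<Rightarrow> nat set" where
  "dmul X Y = (if X \<noteq> {} \<and> Y \<noteq> {} \<and> X \<inter> Y = {} then X \<union> Y else {})"

lemma dadd_idem [simp]: "dadd X X = X"
  by (simp add: dadd_def)

lemma dadd_nonempty: "dadd X Y \<noteq> {} \<Longrightarrow> X = Y"
  by (simp add: dadd_def split: if_splits)

lemma dmul_disjoint: "X \<noteq> {} \<Longrightarrow> Y \<noteq> {} \<Longrightarrow> X \<inter> Y = {} \<Longrightarrow> dmul X Y = X \<union> Y"
  by (simp add: dmul_def)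

lemma dmul_nonempty: "dmul X Y \<noteq> {} \<Longrightarrow> X \<noteq> {} \<and> Y \<noteq> {} \<and> X \<inter> Y = {}"
  by (simp add: dmul_def split: if_splits)

abbreviation "evd \<equiv> ev dadd dmul"

definition IdS :: "nat \<Rightarrow> identity set" where
  "IdS k = Ids (Pow {..<k}) dadd dmul"

lemma evd_in: "(\<And>i. \<sigma> i \<in> Pow {..<k}) \<Longrightarrow> evd \<sigma> t \<in> Pow {..<k}"
  by (rule ev_closed) (auto simp: dadd_def dmul_def)

lemma eq_theory_IdS: "eq_theory (IdS k)"
  unfolding IdS_def by (rule eq_theory_Ids) (auto simp: dadd_def dmul_def)

lemma IdS_antimono: "k \<le> l \<Longrightarrow> IdS l \<subseteq> IdS k"
proof (rule subrelI)
  fix s t assume kl: "k \<le> l" and st: "(s, t) \<in> IdS l"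
  show "(s, t) \<in> IdS k"
    unfolding IdS_def
  proof (rule IdsI)
    fix \<sigma> :: "nat \<Rightarrow> nat set" assume "\<forall>i. \<sigma> i \<in> Pow {..<k}"
    then have "\<And>i. \<sigma> i \<in> Pow {..<l}" using kl by force
    with st show "evd \<sigma> s = evd \<sigma> t" unfolding IdS_def by (rule IdsD)
  qed
qed

lemma IdS_0: "IdS 0 = UNIV"
proof -
  have "(s, t) \<in> IdS 0" for s t
    unfolding IdS_def
  proof (rule IdsI)
    fix \<sigma> :: "nat \<Rightarrow> nat set" assume "\<forall>i. \<sigma> i \<in> Pow {..<0}"
    then have \<sigma>: "\<And>i. \<sigma> i \<in> Pow {..<0}" by simp
    have "evd \<sigma> u = {}" for u :: trm
      using evd_in[of \<sigma> 0 u] \<sigma> by simp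
    then show "evd \<sigma> s = evd \<sigma> t" by simp
  qed
  then show ?thesis by auto
qed

text \<open>The coordinates of the element \<open>X\<close> in a power of S7: the nonzero elements are the
  tuples over \<open>{a, 1}\<close>, seen as characteristic functions.\<close>
definition coord :: "nat \<Rightarrow> nat set \<Rightarrow> el" where
  "coord i X = (if X = {} then Inf else if i \<in> X then A else One)"

lemma coord_in: "coord i X \<in> car7"
  by (simp add: coord_def)

lemma coord_dmul: "dmul X Y \<noteq> {} \<Longrightarrow> coord i (dmul X Y) = mulS (coord i X) (coord i Y)"
  by (auto simp: dmul_def coord_def mulS_def split: if_splits)

text \<open>Nonempty subsets are tuples over \<open>A\<close> and \<open>One\<close> in a power of
  S7, and a nonzero value is computed coordinatewise. Zero is excluded because a vanishing tuple
  need only have one coordinate \<open>Inf\<close>.\<close>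

lemma evd_coord:
  assumes \<sigma>: "\<And>i. \<sigma> i \<in> Pow {..<k}"
  shows "evd \<sigma> t \<noteq> {} \<Longrightarrow> ev7 (\<lambda>x. coord i (\<sigma> x)) t = coord i (evd \<sigma> t)"
proof (induction t)
  case (Pl s t)
  then have "evd \<sigma> s = evd \<sigma> t" by (metis dadd_nonempty ev.simps(2))
  with Pl show ?case by simp
next
  case (Tm s t)
  then have ne: "dmul (evd \<sigma> s) (evd \<sigma> t) \<noteq> {}" by simp
  from dmul_nonempty[OF this] have "evd \<sigma> s \<noteq> {}" "evd \<sigma> t \<noteq> {}" by auto
  with Tm.IH show ?case by (simp add: coord_dmul[OF ne])
qed simp

text \<open>Distinct subsets differ in a coordinate, where their sum is \<open>Inf\<close>; a common
  element gives the product of \<open>A\<close> with itself, again \<open>Inf\<close>. So every zero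
  is visible at some coordinate.\<close>

lemma evd_nonempty:
  assumes \<sigma>: "\<And>i. \<sigma> i \<in> Pow {..<k}" and k: "0 < k"
  shows "(\<And>i. i < k \<Longrightarrow> ev7 (\<lambda>x. coord i (\<sigma> x)) t \<noteq> Inf) \<Longrightarrow> evd \<sigma> t \<noteq> {}"
proof (induction t)
  case (Var x)
  from Var[of 0] k show ?case by (auto simp: coord_def)
next
  case (Pl s t)
  have eq: "ev7 (\<lambda>x. coord i (\<sigma> x)) s = ev7 (\<lambda>x. coord i (\<sigma> x)) t
      \<and> ev7 (\<lambda>x. coord i (\<sigma> x)) s \<noteq> Inf" if "i < k" for i
    using Pl.prems[OF that] fadd_neq fadd_idem by (metis ev.simps(2))
  then have ne: "evd \<sigma> s \<noteq> {}" "evd \<sigma> t \<noteq> {}" using Pl.IH by metis+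
  have "coord i (evd \<sigma> s) = coord i (evd \<sigma> t)" if "i < k" for i
    using eq[OF that] evd_coord[OF \<sigma> ne(1)] evd_coord[OF \<sigma> ne(2)] by simp
  then have "i \<in> evd \<sigma> s \<longleftrightarrow> i \<in> evd \<sigma> t" if "i < k" for i
    using that ne by (simp add: coord_def split: if_splits) (metis el.distinct)+
  moreover have "evd \<sigma> s \<subseteq> {..<k}" "evd \<sigma> t \<subseteq> {..<k}"
    using evd_in[OF \<sigma>] by auto
  ultimately have "evd \<sigma> s = evd \<sigma> t" by blast
  then show ?case using ne by simp
next
  case (Tm s t)
  have p: "mulS (ev7 (\<lambda>x. coord i (\<sigma> x)) s) (ev7 (\<lambda>x. coord i (\<sigma> x)) t) \<noteq> Inf" if "i < k" for i
    using Tm.prems[OF that] by simp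
  have ne: "evd \<sigma> s \<noteq> {}" "evd \<sigma> t \<noteq> {}"
    using Tm.IH mulS_noninf[OF p] by simp_all
  have "i \<notin> evd \<sigma> t" if i: "i \<in> evd \<sigma> s" for i
  proof -
    have "i < k" using evd_in[of \<sigma> k s] \<sigma> i by auto
    from p[OF this] have "mulS (coord i (evd \<sigma> s)) (coord i (evd \<sigma> t)) \<noteq> Inf"
      using evd_coord[OF \<sigma> ne(1), of i] evd_coord[OF \<sigma> ne(2), of i] by simp
    then show ?thesis
      using i by (auto simp: coord_def mulS_def split: if_splits)
  qed
  then have "evd \<sigma> s \<inter> evd \<sigma> t = {}" by blast
  then show ?case using ne by (simp add: dmul_disjoint)
qed

text \<open>For positive \<open>k\<close>, the tuples coded by nonempty subsets and all tuples
  containing \<open>Inf\<close> form a subalgebra of a power of S7; collapsing the latter to one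
  zero gives the subset semiring.\<close>

lemma Id_S7_subset_IdS: "Id_S7 \<subseteq> IdS k"
proof (cases "k = 0")
  case True
  then show ?thesis by (simp add: IdS_0)
next
  case False
  have half: "evd \<sigma> s = evd \<sigma> t"
    if st: "(s, t) \<in> Id_S7" and \<sigma>: "\<And>i. \<sigma> i \<in> Pow {..<k}" and ne: "evd \<sigma> s \<noteq> {}" for s t \<sigma>
  proof -
    have eq: "ev7 (\<lambda>x. coord i (\<sigma> x)) s = ev7 (\<lambda>x. coord i (\<sigma> x)) t" for i
      using st unfolding Id_S7_eq by (rule IdsD) (rule coord_in)
    have c: "ev7 (\<lambda>x. coord i (\<sigma> x)) s = coord i (evd \<sigma> s)" for i
      by (rule evd_coord[OF \<sigma> ne])
    have ne': "evd \<sigma> t \<noteq> {}"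
    proof (rule evd_nonempty[OF \<sigma>])
      show "0 < k" using False by simp
      fix i
      have "coord i (evd \<sigma> s) \<noteq> Inf" using ne by (simp add: coord_def)
      then show "ev7 (\<lambda>x. coord i (\<sigma> x)) t \<noteq> Inf" using eq[of i] c[of i] by simp
    qed
    have "coord i (evd \<sigma> s) = coord i (evd \<sigma> t)" for i
      using eq[of i] c[of i] evd_coord[OF \<sigma> ne', of i] by simp
    then show ?thesis
      using ne ne' by (auto simp: coord_def split: if_splits) (metis el.distinct)+
  qed
  show ?thesis
  proof (rule subrelI)
    fix s t assume st: "(s, t) \<in> Id_S7"
    show "(s, t) \<in> IdS k"
      unfolding IdS_def
    proof (rule IdsI)
      fix \<sigma> :: "nat \<Rightarrow> nat set" assume "\<forall>i. \<sigma> i \<in> Pow {..<k}"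
      then have \<sigma>: "\<And>i. \<sigma> i \<in> Pow {..<k}" by simp
      show "evd \<sigma> s = evd \<sigma> t"
      proof (cases "evd \<sigma> s = {}")
        case True
        show ?thesis
        proof (rule ccontr)
          assume n: "evd \<sigma> s \<noteq> evd \<sigma> t"
          with True have "evd \<sigma> t \<noteq> {}" by simp
          from half[OF eq_theory_sym[OF eq_theory_Id_S7 st] \<sigma> this] n show False by simp
        qed
      next
        case False
        show ?thesis by (rule half[OF st \<sigma> False])
      qed
    qed
  qed
qed

section \<open>Consequences of failing to contain a generator\<close>

interpretation S7_mult: comm_monoid_set mulS One
  by unfold_locales (auto simp: mulS_def)

lemma S7_prod_One:
  assumes "finite X" and "S7_mult.F \<rho> X = One" and "i \<in> X"
  shows "\<rho> i = One"
  using assms by (induction X rule: finite_induct) (auto simp: mulS_def split: if_splits)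

lemma S7_prod_A:
  assumes "finite X" and "S7_mult.F \<rho> X = A"
  shows "\<exists>j\<in>X. \<rho> j = A \<and> (\<forall>i\<in>X - {j}. \<rho> i = One)"
  using assms
proof (induction X rule: finite_induct)
  case (insert x X)
  show ?case
  proof (cases "\<rho> x = One")
    case True
    then show ?thesis using insert by (auto simp: mulS_def)
  next
    case False
    then have "\<rho> x = A" "S7_mult.F \<rho> X = One"
      using insert by (auto simp: mulS_def split: if_splits)
    with S7_prod_One[OF insert(1)] insert(2) show ?thesis by auto
  qed
qed simp

text \<open>The value at the empty list is junk.\<close>
fun lprod :: "nat list \<Rightarrow> trm" where
  "lprod [] = Var 0"
| "lprod [x] = Var x"
| "lprod (x # y # xs) = Tm (Var x) (lprod (y # xs))"

lemma vars_lprod: "xs \<noteq> [] \<Longrightarrow> vars (lprod xs) = set xs"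
  by (induction xs rule: lprod.induct) auto

lemma ev7_lprod: "xs \<noteq> [] \<Longrightarrow> distinct xs \<Longrightarrow> ev7 \<rho> (lprod xs) = S7_mult.F \<rho> (set xs)"
  by (induction xs rule: lprod.induct) auto

lemma evd_lprod:
  "xs \<noteq> [] \<Longrightarrow> distinct xs \<Longrightarrow> (\<And>j. j \<in> set xs \<Longrightarrow> \<delta> j = {j}) \<Longrightarrow> evd \<delta> (lprod xs) = set xs"
proof (induction xs rule: lprod.induct)
  case (3 x y xs)
  from 3 have "evd \<delta> (lprod (y # xs)) = set (y # xs)" by simp
  moreover have "\<delta> x = {x}" "x \<notin> set (y # xs)" using 3 by auto
  ultimately show ?case by (simp add: dmul_disjoint insert_commute)
qed auto

abbreviation linear_word :: "nat \<Rightarrow> trm" where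
  "linear_word k \<equiv> lprod [0..<k]"

text \<open>A subset stands for the product of its letters. Nonzero products are disjoint unions, so
  an instance of \<open>s\<close> becomes a product over the value of \<open>s\<close> without
  repeated letters.\<close>

lemma evd_substitution:
  assumes f: "\<And>x. \<sigma> x \<noteq> {} \<Longrightarrow> ev7 \<rho> (f x) = S7_mult.F \<rho> (\<sigma> x)"
    and fin: "\<And>x. finite (\<sigma> x)"
  shows "evd \<sigma> s \<noteq> {} \<Longrightarrow> ev7 \<rho> (subst f s) = S7_mult.F \<rho> (evd \<sigma> s) \<and> finite (evd \<sigma> s)"
proof (induction s)
  case (Var x)
  then show ?case using f fin by simp
next
  case (Pl s t)
  then have "evd \<sigma> s = evd \<sigma> t" using dadd_nonempty by simp
  with Pl show ?case by simp
next
  case (Tm s t)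
  then have "evd \<sigma> s \<noteq> {}" "evd \<sigma> t \<noteq> {}" "evd \<sigma> s \<inter> evd \<sigma> t = {}"
    using dmul_nonempty[of "evd \<sigma> s" "evd \<sigma> t"] by simp_all
  with Tm.IH show ?case by (simp add: dmul_disjoint S7_mult.union_disjoint)
qed

lemma ev7_One: "(\<And>i. i \<in> vars t \<Longrightarrow> \<rho> i = One) \<Longrightarrow> ev7 \<rho> t = One"
  by (induction t) (simp_all add: mulS_def)

text \<open>Idempotence supplies further copies of \<open>w\<close>, each of which may be replaced
  by some \<open>u\<close>.\<close>

lemma theory_absorb:
  assumes T: "eq_theory T" and S7: "Id_S7 \<subseteq> T"
  shows "(\<And>u. u \<in> set us \<Longrightarrow> (w, u) \<in> T) \<Longrightarrow> (w, foldr Pl us w) \<in> T"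
proof (induction us)
  case (Cons u us)
  have "(w, Pl w w) \<in> Id_S7" by (rule Id_S7I) simp
  then have "(w, Pl w w) \<in> T" using S7 by blast
  moreover have "(Pl w w, Pl u (foldr Pl us w)) \<in> T"
    using Cons by (intro eq_theory_Pl[OF T]) auto
  ultimately show ?case using eq_theory_trans[OF T] by simp
qed (simp add: eq_theory_refl[OF T])

lemma ev7_foldr_Pl:
  "ev7 \<rho> (foldr Pl us w) = (if \<forall>u\<in>set us. ev7 \<rho> u = ev7 \<rho> w then ev7 \<rho> w else Inf)"
  by (induction us) (auto simp: fadd_neq, auto simp: fadd_def)

text \<open>The hypothesis yields \<open>x\<^sub>0\<dots>x\<^bsub>k-1\<^esub> \<approx> t\<close> with \<open>t \<noteq> a\<close> under some assignment of \<open>a\<close>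
  to one variable and \<open>1\<close> to the others. Adding up the images of \<open>t\<close> under the
  transpositions makes the sum differ from \<open>a\<close> under every such assignment, as
  \<open>(x\<^sub>0\<dots>x\<^bsub>k-1\<^esub>)\<^sup>2\<close> does.\<close>
lemma linear_word_nil:
  assumes T: "eq_theory T" and S7: "Id_S7 \<subseteq> T" and k: "0 < k" and "\<not> T \<subseteq> IdS k"
  shows "(linear_word k, Tm (linear_word k) (linear_word k)) \<in> T"
proof -
  let ?w = "linear_word k"
  from \<open>\<not> T \<subseteq> IdS k\<close> obtain s t \<sigma>
    where st: "(s, t) \<in> T" and \<sigma>: "\<And>i. \<sigma> i \<in> Pow {..<k}" and neq: "evd \<sigma> s \<noteq> evd \<sigma> t"
      and ne: "evd \<sigma> s \<noteq> {}"
  proof -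
    from \<open>\<not> T \<subseteq> IdS k\<close> obtain s t \<sigma>
      where "(s, t) \<in> T" "\<forall>i. \<sigma> i \<in> Pow {..<k}" "evd \<sigma> s \<noteq> evd \<sigma> t"
      by (auto simp: IdS_def Ids_def)
    then show ?thesis
      using that[of s t \<sigma>] that[of t s \<sigma>] eq_theory_sym[OF T] by (cases "evd \<sigma> s = {}") auto
  qed
  have fin\<sigma>: "finite (\<sigma> x)" for x
    using \<sigma>[of x] finite_subset by blast
  have w7: "ev7 \<rho> ?w = S7_mult.F \<rho> {..<k}" for \<rho>
    using ev7_lprod[of "[0..<k]" \<rho>] k by (simp add: atLeast0LessThan)
  have w_vars: "vars ?w = {..<k}"
    using vars_lprod[of "[0..<k]"] k by (simp add: atLeast0LessThan)
  \<comment> \<open>A variable with value zero becomes a square, which vanishes under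
    \<open>\<delta>\<close>; thus \<open>f\<close> followed by \<open>\<delta>\<close> reproduces
    \<open>\<sigma>\<close>.\<close>
  define f where "f x = (if \<sigma> x = {} then Tm ?w ?w else lprod (sorted_list_of_set (\<sigma> x)))" for x
  define R where "R = {..<k} - evd \<sigma> s"
  \<comment> \<open>The letters missing from the value of \<open>s\<close> complete it to the full
    word. The case distinction is there because no term denotes the empty product.\<close>
  define g where "g u = (if R = {} then u else Tm u (lprod (sorted_list_of_set R)))" for u
  define \<delta> where "\<delta> j = (if j < k then {j} else {})" for j
  have finR: "finite R" by (simp add: R_def)
  have sl: "sorted_list_of_set X \<noteq> []" if "finite X" "X \<noteq> {}" for X :: "nat set"
    using that by simp
  have wd: "evd \<delta> ?w = {..<k}"
    using evd_lprod[of "[0..<k]" \<delta>] k by (simp add: atLeast0LessThan \<delta>_def)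
  have in_k: "evd \<sigma> u \<subseteq> {..<k}" for u
    using evd_in[of \<sigma> k u] \<sigma> by simp
  have d_lprod: "evd \<delta> (lprod (sorted_list_of_set X)) = X" if "X \<noteq> {}" "X \<subseteq> {..<k}" for X
  proof -
    have "finite X" using that finite_subset by blast
    moreover have "\<delta> j = {j}" if "j \<in> X" for j
      using that \<open>X \<subseteq> {..<k}\<close> by (auto simp: \<delta>_def)
    ultimately show ?thesis
      using evd_lprod[of "sorted_list_of_set X" \<delta>] that by simp
  qed
  have fd: "evd \<delta> (f x) = \<sigma> x" for x
  proof (cases "\<sigma> x = {}")
    case True
    then show ?thesis using k by (simp add: f_def wd dmul_def)
  next
    case False
    then show ?thesis using d_lprod[of "\<sigma> x"] \<sigma>[of x] by (simp add: f_def)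
  qed
  have fv: "vars (f x) \<subseteq> {..<k}" for x
    using \<sigma>[of x] vars_lprod[OF sl[OF fin\<sigma>[of x]]] fin\<sigma>[of x] w_vars by (auto simp: f_def)
  define t' where "t' = g (subst f t)"
  have t'_vars: "vars t' \<subseteq> {..<k}"
    using fv vars_lprod[OF sl[OF finR]] finR by (auto simp: t'_def g_def vars_subst) (auto simp: R_def)
  have t'd: "evd \<delta> t' \<noteq> {..<k}"
  proof (cases "R = {}")
    case True
    then have "evd \<sigma> s = {..<k}" using in_k[of s] by (auto simp: R_def)
    then show ?thesis using True neq by (simp add: t'_def g_def ev_subst fd)
  next
    case False
    have "evd \<delta> t' = dmul (evd \<sigma> t) R"
      using False d_lprod[of R] by (simp add: t'_def g_def ev_subst fd R_def)
    moreover have "dmul (evd \<sigma> t) R \<noteq> {..<k}"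
    proof
      assume eq: "dmul (evd \<sigma> t) R = {..<k}"
      then have "dmul (evd \<sigma> t) R \<noteq> {}" using k by auto
      from dmul_nonempty[OF this] have *: "evd \<sigma> t \<inter> R = {}" "evd \<sigma> t \<union> R = {..<k}"
        using eq dmul_disjoint by auto
      then have "evd \<sigma> t = evd \<sigma> s" using in_k[of s] by (auto simp: R_def)
      with neq show False by simp
    qed
    ultimately show ?thesis by simp
  qed
  have wt': "(?w, t') \<in> T"
  proof -
    have "(?w, g (subst f s)) \<in> Id_S7"
    proof (rule Id_S7I)
      fix \<rho> :: "nat \<Rightarrow> el" assume "\<forall>i. \<rho> i \<in> car7"
      have l: "ev7 \<rho> (lprod (sorted_list_of_set X)) = S7_mult.F \<rho> X" if "finite X" "X \<noteq> {}" for X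
        using ev7_lprod[OF sl[OF that], of \<rho>] that by simp
      have e: "ev7 \<rho> (subst f s) = S7_mult.F \<rho> (evd \<sigma> s) \<and> finite (evd \<sigma> s)"
        by (rule evd_substitution) (auto simp: f_def l fin\<sigma> ne)
      show "ev7 \<rho> ?w = ev7 \<rho> (g (subst f s))"
      proof (cases "R = {}")
        case True
        then have "evd \<sigma> s = {..<k}" using in_k[of s] by (auto simp: R_def)
        with True e show ?thesis by (simp add: w7 g_def)
      next
        case False
        have "evd \<sigma> s \<inter> R = {}" "evd \<sigma> s \<union> R = {..<k}"
          using in_k[of s] by (auto simp: R_def)
        then have "S7_mult.F \<rho> {..<k} = mulS (S7_mult.F \<rho> (evd \<sigma> s)) (S7_mult.F \<rho> R)"
          using S7_mult.union_disjoint[of "evd \<sigma> s" R \<rho>] e finR by simp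
        with False e show ?thesis by (simp add: w7 g_def l finR)
      qed
    qed
    moreover have "(g (subst f s), t') \<in> T"
      using eq_theory_subst[OF T st, of f] by (auto simp: t'_def g_def intro: eq_theory_Tm[OF T] eq_theory_refl[OF T])
    ultimately show ?thesis using S7 eq_theory_trans[OF T] by blast
  qed
  have \<delta>in: "\<And>j. \<delta> j \<in> Pow {..<k}" by (simp add: \<delta>_def)
  \<comment> \<open>If every coordinate had the value \<open>A\<close>, the value of
    \<open>t'\<close> under \<open>\<delta>\<close> would be all of \<open>{..<k}\<close>, against
    \<open>t'd\<close>.\<close>
  have "\<exists>i<k. ev7 (\<lambda>x. coord i (\<delta> x)) t' \<noteq> A"
  proof (rule ccontr)
    assume "\<not> (\<exists>i<k. ev7 (\<lambda>x. coord i (\<delta> x)) t' \<noteq> A)"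
    then have A: "ev7 (\<lambda>x. coord i (\<delta> x)) t' = A" if "i < k" for i
      using that by blast
    then have ne': "evd \<delta> t' \<noteq> {}"
      using evd_nonempty[of \<delta> k t'] \<delta>in k by simp
    have "i \<in> evd \<delta> t'" if "i < k" for i
      using A[OF that] evd_coord[of \<delta> k t' i] \<delta>in ne' by (simp add: coord_def split: if_splits)
    moreover have "evd \<delta> t' \<subseteq> {..<k}" using evd_in[of \<delta> k t'] \<delta>in by simp
    ultimately have "evd \<delta> t' = {..<k}" by auto
    with t'd show False by simp
  qed
  then obtain i where i: "i < k" "ev7 (\<lambda>x. coord i (\<delta> x)) t' \<noteq> A" by blast
  define sw where "sw j x = (if x = i then j else if x = j then i else x)" for j x :: nat
  define us where "us = map (\<lambda>j. subst (\<lambda>x. Var (sw j x)) t') [0..<k]"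
  have "(?w, u) \<in> T" if "u \<in> set us" for u
  proof -
    from that obtain j where j: "j < k" and u: "u = subst (\<lambda>x. Var (sw j x)) t'"
      by (auto simp: us_def)
    have bij: "bij_betw (sw j) {..<k} {..<k}"
      by (rule bij_betw_byWitness[where f' = "sw j"]) (use i(1) j in \<open>auto simp: sw_def\<close>)
    have "(?w, subst (\<lambda>x. Var (sw j x)) ?w) \<in> Id_S7"
    proof (rule Id_S7I)
      fix \<rho> :: "nat \<Rightarrow> el"
      have "S7_mult.F (\<lambda>x. \<rho> (sw j x)) {..<k} = S7_mult.F \<rho> {..<k}"
        by (rule S7_mult.reindex_bij_betw[OF bij])
      then show "ev7 \<rho> ?w = ev7 \<rho> (subst (\<lambda>x. Var (sw j x)) ?w)"
        by (simp add: ev_subst w7)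
    qed
    then have "(?w, subst (\<lambda>x. Var (sw j x)) ?w) \<in> T" using S7 by blast
    from eq_theory_trans[OF T this eq_theory_subst[OF T wt']] show ?thesis by (simp add: u)
  qed
  from theory_absorb[OF T S7 this] have *: "(?w, foldr Pl us ?w) \<in> T" .
  have "(foldr Pl us ?w, Tm ?w ?w) \<in> Id_S7"
  proof (rule Id_S7I)
    fix \<rho> :: "nat \<Rightarrow> el" assume \<rho>: "\<forall>i. \<rho> i \<in> car7"
    have "ev7 \<rho> ?w \<in> car7" using ev7_in[of \<rho> ?w] \<rho> by blast
    then consider "ev7 \<rho> ?w = Inf" | "ev7 \<rho> ?w = One" | "ev7 \<rho> ?w = A" by blast
    then show "ev7 \<rho> (foldr Pl us ?w) = ev7 \<rho> (Tm ?w ?w)"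
    proof cases
      case 1
      then show ?thesis by (simp add: ev7_foldr_Pl mulS_def)
    next
      case 2
      then have one: "\<rho> x = One" if "x < k" for x
        using S7_prod_One[of "{..<k}" \<rho> x] that by (simp add: w7)
      have "ev7 \<rho> u = One" if u: "u \<in> set us" for u
      proof (rule ev7_One)
        fix x assume "x \<in> vars u"
        then have "x < k" using u t'_vars i(1) by (auto simp: us_def vars_subst sw_def split: if_splits)
        then show "\<rho> x = One" by (rule one)
      qed
      then show ?thesis using 2 by (simp add: ev7_foldr_Pl mulS_def)
    next
      case 3
      then obtain j where j: "j < k" "\<rho> j = A" "\<And>x. x < k \<Longrightarrow> x \<noteq> j \<Longrightarrow> \<rho> x = One"
        using S7_prod_A[of "{..<k}" \<rho>] by (auto simp: w7)
      let ?u = "subst (\<lambda>x. Var (sw j x)) t'"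
      have "ev7 \<rho> ?u = ev7 (\<lambda>x. coord i (\<delta> x)) t'"
        unfolding ev_subst
        by (rule ev_cong) (use t'_vars j i in \<open>auto simp: sw_def coord_def \<delta>_def\<close>)
      then have "ev7 \<rho> ?u \<noteq> A" using i by simp
      moreover have "?u \<in> set us" using j by (auto simp: us_def)
      ultimately have "\<not> (\<forall>u\<in>set us. ev7 \<rho> u = ev7 \<rho> ?w)" using 3 by metis
      then show ?thesis using 3 by (simp add: ev7_foldr_Pl mulS_def)
    qed
  qed
  then have "(foldr Pl us ?w, Tm ?w ?w) \<in> T" using S7 by blast
  from eq_theory_trans[OF T * this] show ?thesis .
qed

section \<open>The semiring M2 and the equality of all squares\<close>

lemma Id_M2_eq: "Id_M2 = Ids {One, Inf} fadd mulS"
proof -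
  have m: "mulM2 x y = mulS x y" if "x \<in> {One, Inf}" "y \<in> {One, Inf}" for x y
    using that by (auto simp: mulS_def)
  have i: "ev7 \<sigma> t \<in> {One, Inf}" if "\<And>i. \<sigma> i \<in> {One, Inf}" for \<sigma> t
    by (rule ev_closed) (use that in \<open>auto simp: fadd_def mulS_def\<close>)
  have "ev fadd mulM2 \<sigma> t = ev7 \<sigma> t" if "\<And>i. \<sigma> i \<in> {One, Inf}" for \<sigma> t
    using i[OF that] by (induction t) (simp_all add: m)
  then show ?thesis by (auto simp: Id_M2_def Id_alg_eq_Ids Ids_def)
qed

lemma eq_theory_Id_M2: "eq_theory Id_M2"
  unfolding Id_M2_eq by (rule eq_theory_Ids) (auto simp: fadd_def mulS_def)

lemma Id_S7_subset_Id_M2: "Id_S7 \<subseteq> Id_M2"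
  unfolding Id_S7_eq Id_M2_eq by (auto simp: Ids_def)

text \<open>Take an assignment in M2 separating \<open>s\<close> (value \<open>One\<close>) from
  \<open>t\<close> (value \<open>Inf\<close>). Replacing variables of value \<open>One\<close> by
  \<open>x^2\<close> and the others by \<open>x^2 y^2\<close> turns \<open>s\<close> into
  \<open>x^2\<close> and \<open>t\<close> into \<open>x^2 y^2\<close> modulo S7, as squares take
  only the values \<open>One\<close> and \<open>Inf\<close>. Exchanging \<open>x\<close> and
  \<open>y\<close> finishes the proof.\<close>

lemma squares_equal:
  assumes T: "eq_theory T" and S7: "Id_S7 \<subseteq> T" and "\<not> T \<subseteq> Id_M2"
  shows "(Tm (Var 0) (Var 0), Tm (Var 1) (Var 1)) \<in> T"
proof -
  from \<open>\<not> T \<subseteq> Id_M2\<close> obtain s t \<sigma>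
    where "(s, t) \<in> T" and \<sigma>: "\<And>i. \<sigma> i \<in> {One, Inf}" and neq: "ev7 \<sigma> s \<noteq> ev7 \<sigma> t"
    unfolding Id_M2_eq Ids_def by blast
  have c: "ev7 \<sigma> u \<in> {One, Inf}" for u
    by (rule ev_closed) (use \<sigma> in \<open>auto simp: fadd_def mulS_def\<close>)
  obtain s t where st: "(s, t) \<in> T" and s: "ev7 \<sigma> s = One" and t: "ev7 \<sigma> t = Inf"
    using c[of s] c[of t] neq \<open>(s, t) \<in> T\<close> eq_theory_sym[OF T] by auto
  let ?xx = "Tm (Var 0) (Var 0)" and ?yy = "Tm (Var 1) (Var 1)"
  define f where "f i = (if \<sigma> i = One then ?xx else Tm ?xx ?yy)" for i
  have key: "ev7 \<rho> (subst f u) = (if \<rho> 0 = One \<and> (ev7 \<sigma> u = One \<or> \<rho> 1 = One) then One else Inf)"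
    if \<rho>: "\<forall>i. \<rho> i \<in> car7" for \<rho> u
  proof -
    have v: "ev7 \<rho> (f i) = (if \<rho> 0 = One \<and> (\<sigma> i = One \<or> \<rho> 1 = One) then One else Inf)" for i
      using \<rho>[rule_format, of 0] \<rho>[rule_format, of 1] by (auto simp: f_def mulS_def)
    show ?thesis
    proof (cases "\<rho> 0 = One")
      case False
      have "ev7 (\<lambda>i. ev7 \<rho> (f i)) u = Inf"
        unfolding v using False by (induction u) (simp_all add: mulS_def)
      with False show ?thesis by (simp add: ev_subst)
    next
      case True
      show ?thesis
      proof (cases "\<rho> 1 = One")
        case one: True
        have "ev7 (\<lambda>i. ev7 \<rho> (f i)) u = One"
          by (rule ev7_One) (simp add: v True one[simplified])
        with True one show ?thesis by (simp add: ev_subst)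
      next
        case False
        then have "(\<lambda>i. ev7 \<rho> (f i)) = \<sigma>"
          using True \<sigma> by (fastforce simp: v)
        with True False c[of u] show ?thesis by (auto simp: ev_subst)
      qed
    qed
  qed
  have "(?xx, subst f s) \<in> Id_S7"
    by (rule Id_S7I) (simp add: key s, auto simp: mulS_def)
  moreover have "(subst f t, Tm ?xx ?yy) \<in> Id_S7"
    by (rule Id_S7I) (simp add: key t, auto simp: mulS_def)
  ultimately have 1: "(?xx, Tm ?xx ?yy) \<in> T"
    using eq_theory_trans[OF T] eq_theory_subst[OF T st, of f] S7 by blast
  let ?h = "\<lambda>i. if i = 0 then Var 1 else Var 0"
  from eq_theory_subst[OF T 1, of ?h] have "(?yy, Tm ?yy ?xx) \<in> T" by simp
  moreover have "(Tm ?yy ?xx, Tm ?xx ?yy) \<in> Id_S7"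
    by (rule Id_S7I) (simp add: S7_mult.commute)
  ultimately have "(?yy, Tm ?xx ?yy) \<in> T"
    using eq_theory_trans[OF T] S7 by blast
  from eq_theory_trans[OF T 1 eq_theory_sym[OF T this]] show ?thesis .
qed

section \<open>Completeness\<close>

text \<open>Closure under walks of length three makes the ends of every odd walk adjacent, so every
  component is complete bipartite. Nonadjacent \<open>a\<close> and \<open>b\<close> lie on the same
  side or in different components, and components are coloured independently.\<close>

lemma two_colouring:
  fixes E :: "nat \<Rightarrow> nat \<Rightarrow> bool"
  assumes sym: "\<And>x y. E x y \<Longrightarrow> E y x" and irrefl: "\<And>x. \<not> E x x"
    and closed: "\<And>x y z w. E x y \<Longrightarrow> E y z \<Longrightarrow> E z w \<Longrightarrow> E x w"
    and "\<not> E a b"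
  shows "\<exists>c :: nat \<Rightarrow> bool. (\<forall>x y. E x y \<longrightarrow> c x \<noteq> c y) \<and> c a = c b"
proof -
  \<comment> \<open>Being joined by an even walk; by closure, lengths 0 and 2 suffice.\<close>
  define R where "R u v \<longleftrightarrow> u = v \<or> (\<exists>z. E u z \<and> E z v)" for u v
  have Rsym: "R u v \<Longrightarrow> R v u" for u v unfolding R_def using sym by blast
  have RE: "R u v \<Longrightarrow> E v w \<Longrightarrow> E u w" for u v w unfolding R_def using closed by blast
  have ER: "E u v \<Longrightarrow> R v w \<Longrightarrow> E u w" for u v w unfolding R_def using closed by blast
  have EE: "E u v \<Longrightarrow> E v w \<Longrightarrow> R u w" for u v w unfolding R_def by blast
  have RR: "R u w" if uv: "R u v" and vw: "R v w" for u v w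
  proof (cases "v = w")
    case False
    then obtain z where "E v z" "E z w" using vw unfolding R_def by blast
    then show ?thesis using RE[OF uv] unfolding R_def by blast
  qed (use uv in simp)
  have ER_False: "E u v \<Longrightarrow> \<not> R u v" for u v
    using ER[of u v u] Rsym irrefl by blast
  define comp where "comp v u \<longleftrightarrow> R v u \<or> E v u" for v u
  have comp_refl: "comp v v" for v by (simp add: comp_def R_def)
  have comp_sym: "comp u v \<Longrightarrow> comp v u" for u v
    unfolding comp_def using sym Rsym by blast
  have comp_trans: "comp u v \<Longrightarrow> comp v w \<Longrightarrow> comp u w" for u v w
    unfolding comp_def using RE ER EE RR by blast
  \<comment> \<open>A root depending only on the component. Both \<open>a\<close> and
    \<open>b\<close> are roots unless they share a component, and then \<open>b\<close> is on the
    side of the root \<open>a\<close>.\<close>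
  define r where "r v = (if comp v a then a else if comp v b then b else LEAST u. comp v u)" for v
  have comp_r: "comp v (r v)" for v
    unfolding r_def using LeastI[of "comp v" v] comp_refl by auto
  have r_eq: "r u = r v" if "comp u v" for u v
  proof -
    have "comp u = comp v" using comp_trans comp_sym that by blast
    then show ?thesis by (simp add: r_def)
  qed
  define c where "c v \<longleftrightarrow> R (r v) v" for v
  have "c x \<noteq> c y" if E: "E x y" for x y
  proof -
    have r: "r y = r x" using E r_eq[of x y] by (simp add: comp_def)
    have "comp x (r x)" by (rule comp_r)
    then consider "R (r x) x" | "E (r x) x" using Rsym sym by (auto simp: comp_def)
    then show ?thesis
    proof cases
      case 1
      then have "E (r x) y" using RE E by blast
      then show ?thesis using 1 r ER_False by (simp add: c_def)
    next
      case 2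
      then have "R (r x) y" using EE E by blast
      then show ?thesis using 2 r ER_False by (simp add: c_def)
    qed
  qed
  moreover have "c a = c b"
  proof -
    have "c a" by (simp add: c_def r_def comp_refl) (simp add: R_def)
    moreover have "c b"
    proof (cases "comp b a")
      case True
      then have "R b a" using \<open>\<not> E a b\<close> sym by (auto simp: comp_def)
      with True show ?thesis by (simp add: c_def r_def Rsym)
    next
      case False
      then show ?thesis by (simp add: c_def r_def comp_refl) (simp add: R_def)
    qed
    ultimately show ?thesis by simp
  qed
  ultimately show ?thesis by blast
qed

section \<open>Monomials of a term\<close>

primrec monomials :: "trm \<Rightarrow> trm set" where
  "monomials (Var i) = {Var i}"
| "monomials (Pl s t) = monomials s \<union> monomials t"
| "monomials (Tm s t) = {Tm m n | m n. m \<in> monomials s \<and> n \<in> monomials t}"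

primrec no_Pl :: "trm \<Rightarrow> bool" where
  "no_Pl (Var i) = True"
| "no_Pl (Pl s t) = False"
| "no_Pl (Tm s t) = (no_Pl s \<and> no_Pl t)"

lemma no_Pl_monomial: "m \<in> monomials t \<Longrightarrow> no_Pl m"
  by (induction t arbitrary: m) auto

lemma monomials_nonempty: "\<exists>m. m \<in> monomials t"
  by (induction t) auto

lemma evd_monomial: "evd \<sigma> t \<noteq> {} \<Longrightarrow> m \<in> monomials t \<Longrightarrow> evd \<sigma> m = evd \<sigma> t"
proof (induction t arbitrary: m)
  case (Pl s t)
  have eq: "evd \<sigma> s = evd \<sigma> t" using dadd_nonempty Pl.prems(1) by simp
  then have "evd \<sigma> s \<noteq> {}" "evd \<sigma> t \<noteq> {}" using Pl.prems(1) by simp_all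
  then have "evd \<sigma> m = evd \<sigma> s \<or> evd \<sigma> m = evd \<sigma> t"
    using Pl.IH[of m] Pl.prems(2) by fastforce
  with eq show ?case by auto
next
  case (Tm s t)
  have "evd \<sigma> s \<noteq> {}" "evd \<sigma> t \<noteq> {}"
    using dmul_nonempty[of "evd \<sigma> s" "evd \<sigma> t"] Tm.prems(1) by simp_all
  moreover obtain m1 m2 where m: "m = Tm m1 m2" "m1 \<in> monomials s" "m2 \<in> monomials t"
    using Tm.prems(2) by auto
  ultimately have "evd \<sigma> m1 = evd \<sigma> s" "evd \<sigma> m2 = evd \<sigma> t"
    using Tm.IH by blast+
  then show ?case by (simp add: m(1))
qed simp

text \<open>In a product, fix a monomial of one factor: every monomial of the other factor has the
  complement of its value in \<open>X\<close>, hence all of them have the same value.\<close>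

lemma evd_if_monomials:
  "X \<noteq> {} \<Longrightarrow> (\<And>m. m \<in> monomials t \<Longrightarrow> evd \<sigma> m = X) \<Longrightarrow> evd \<sigma> t = X"
proof (induction t arbitrary: X)
  case (Tm s t)
  obtain m0 n0 where m0: "m0 \<in> monomials s" and n0: "n0 \<in> monomials t"
    using monomials_nonempty by blast
  have p: "dmul (evd \<sigma> m) (evd \<sigma> n) = X" if "m \<in> monomials s" "n \<in> monomials t" for m n
    using Tm.prems(2)[of "Tm m n"] that by auto
  have split: "evd \<sigma> m \<noteq> {} \<and> evd \<sigma> n \<noteq> {} \<and> evd \<sigma> m = X - evd \<sigma> n \<and> evd \<sigma> n = X - evd \<sigma> m"
    if "m \<in> monomials s" "n \<in> monomials t" for m n
  proof -
    have ne: "evd \<sigma> m \<noteq> {}" "evd \<sigma> n \<noteq> {}" "evd \<sigma> m \<inter> evd \<sigma> n = {}"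
      using dmul_nonempty[of "evd \<sigma> m" "evd \<sigma> n"] p[OF that] Tm.prems(1) by auto
    then have "evd \<sigma> m \<union> evd \<sigma> n = X" using p[OF that] by (simp add: dmul_disjoint)
    with ne show ?thesis by blast
  qed
  have "evd \<sigma> s = evd \<sigma> m0"
  proof (rule Tm.IH(1))
    show "evd \<sigma> m0 \<noteq> {}" using split[OF m0 n0] by blast
    fix m assume "m \<in> monomials s"
    from split[OF this n0] split[OF m0 n0] show "evd \<sigma> m = evd \<sigma> m0" by argo
  qed
  moreover have "evd \<sigma> t = evd \<sigma> n0"
  proof (rule Tm.IH(2))
    show "evd \<sigma> n0 \<noteq> {}" using split[OF m0 n0] by blast
    fix n assume "n \<in> monomials t"
    from split[OF m0 this] split[OF m0 n0] show "evd \<sigma> n = evd \<sigma> n0" by argo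
  qed
  ultimately show ?case using p[OF m0 n0] by simp
next
  case (Pl s t)
  have "evd \<sigma> s = X"
    by (rule Pl.IH(1)) (use Pl.prems in simp_all)
  moreover have "evd \<sigma> t = X"
    by (rule Pl.IH(2)) (use Pl.prems in simp_all)
  ultimately show ?case by simp
qed simp

text \<open>Besides the axioms of commutative ai-semirings: \<open>x\<^sup>2 + y = x\<^sup>2 y\<^sup>2\<close>, \<open>x\<^sup>4 = x\<^sup>2\<close>,
  \<open>x + xy = x + xy + xyy\<close> and \<open>xy + yz + zw = xy + yz + zw + xw\<close>.\<close>
definition S7_basis :: "identity set" where
  "S7_basis =
    (let x = Var 0; y = Var 1; z = Var 2; w = Var 3 in
     {(Pl x y, Pl y x), (Pl (Pl x y) z, Pl x (Pl y z)), (Pl x x, x),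
      (Tm x y, Tm y x), (Tm (Tm x y) z, Tm x (Tm y z)),
      (Tm x (Pl y z), Pl (Tm x y) (Tm x z)),
      (Pl (Tm x x) y, Tm (Tm x x) (Tm y y)),
      (Tm (Tm x x) (Tm x x), Tm x x),
      (Pl x (Tm x y), Pl (Pl x (Tm x y)) (Tm (Tm x y) y)),
      (Pl (Tm x y) (Pl (Tm y z) (Tm z w)), Pl (Pl (Tm x y) (Pl (Tm y z) (Tm z w))) (Tm x w))})"

text \<open>The added identity makes every product of three factors equal to its square, which
  leaves only monomials of degree at most two to study.\<close>

definition basis :: "identity set" where
  "basis = insert (let u = Tm (Tm (Var 0) (Var 1)) (Var 2) in (u, Tm u u)) S7_basis"

section \<open>The quotient of the term algebra by a theory containing the basis\<close>

locale basis_theory =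
  fixes T :: "identity set"
  assumes T: "eq_theory T" and basis: "basis \<subseteq> T"
begin

definition q :: "trm \<Rightarrow> trm set" where "q t = {u. (t, u) \<in> T}"

definition rep :: "trm set \<Rightarrow> trm" where "rep X = (SOME t. t \<in> X)"

text \<open>Defined through representatives on arbitrary sets of terms, so that the semigroup laws
  hold on the whole type and not only for congruence classes.\<close>

definition padd :: "trm set \<Rightarrow> trm set \<Rightarrow> trm set" (infixl "\<oplus>" 65) where
  "X \<oplus> Y = q (Pl (rep X) (rep Y))"

definition pmul :: "trm set \<Rightarrow> trm set \<Rightarrow> trm set" (infixl "\<otimes>" 70) where
  "X \<otimes> Y = q (Tm (rep X) (rep Y))"

lemma q_eq: "q s = q t \<longleftrightarrow> (s, t) \<in> T"
  unfolding q_def using eq_theory_refl[OF T] eq_theory_sym[OF T] eq_theory_trans[OF T] by blast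

lemma q_rep: "q (rep (q t)) = q t"
proof -
  have "t \<in> q t" by (simp add: q_def eq_theory_refl[OF T])
  then have "rep (q t) \<in> q t" unfolding rep_def by (rule someI)
  then have "(t, rep (q t)) \<in> T" by (simp add: q_def)
  then show ?thesis using q_eq[of t "rep (q t)"] by simp
qed

lemma q_Pl: "q (Pl s t) = q s \<oplus> q t"
  unfolding padd_def q_eq
  by (rule eq_theory_Pl[OF T]) (simp_all add: q_rep flip: q_eq)

lemma q_Tm: "q (Tm s t) = q s \<otimes> q t"
  unfolding pmul_def q_eq
  by (rule eq_theory_Tm[OF T]) (simp_all add: q_rep flip: q_eq)

lemma padd_q: "X \<oplus> Y = q (rep X) \<oplus> q (rep Y)"
  by (simp only: padd_def[of X Y] q_Pl)

lemma pmul_q: "X \<otimes> Y = q (rep X) \<otimes> q (rep Y)"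
  by (simp only: pmul_def[of X Y] q_Tm)

lemma q_instance:
  assumes "(s, t) \<in> basis"
  shows "q (subst (\<lambda>i. [a, b, c, d] ! i) s) = q (subst (\<lambda>i. [a, b, c, d] ! i) t)"
  using eq_theory_subst[OF T, of s t] assms basis by (auto simp: q_eq)

lemma q_add_commute: "q a \<oplus> q b = q b \<oplus> q a"
  using q_instance[of "Pl (Var 0) (Var 1)" "Pl (Var 1) (Var 0)" a b c d]
  by (simp add: basis_def S7_basis_def Let_def q_Pl q_Tm eval_nat_numeral)

lemma q_add_assoc: "q a \<oplus> q b \<oplus> q c = q a \<oplus> (q b \<oplus> q c)"
  using q_instance[of "Pl (Pl (Var 0) (Var 1)) (Var 2)" "Pl (Var 0) (Pl (Var 1) (Var 2))" a b c d]
  by (simp add: basis_def S7_basis_def Let_def q_Pl q_Tm eval_nat_numeral)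

lemma q_add_idem: "q a \<oplus> q a = q a"
  using q_instance[of "Pl (Var 0) (Var 0)" "Var 0" a b c d]
  by (simp add: basis_def S7_basis_def Let_def q_Pl q_Tm eval_nat_numeral)

lemma q_mul_commute: "q a \<otimes> q b = q b \<otimes> q a"
  using q_instance[of "Tm (Var 0) (Var 1)" "Tm (Var 1) (Var 0)" a b c d]
  by (simp add: basis_def S7_basis_def Let_def q_Pl q_Tm eval_nat_numeral)

lemma q_mul_assoc: "q a \<otimes> q b \<otimes> q c = q a \<otimes> (q b \<otimes> q c)"
  using q_instance[of "Tm (Tm (Var 0) (Var 1)) (Var 2)" "Tm (Var 0) (Tm (Var 1) (Var 2))" a b c d]
  by (simp add: basis_def S7_basis_def Let_def q_Pl q_Tm eval_nat_numeral)

lemma q_distrib: "q a \<otimes> (q b \<oplus> q c) = q a \<otimes> q b \<oplus> q a \<otimes> q c"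
  using q_instance[of "Tm (Var 0) (Pl (Var 1) (Var 2))" "Pl (Tm (Var 0) (Var 1)) (Tm (Var 0) (Var 2))" a b c d]
  by (simp add: basis_def S7_basis_def Let_def q_Pl q_Tm eval_nat_numeral)

lemma q_square_add: "q a \<otimes> q a \<oplus> q b = q a \<otimes> q a \<otimes> (q b \<otimes> q b)"
  using q_instance[of "Pl (Tm (Var 0) (Var 0)) (Var 1)" "Tm (Tm (Var 0) (Var 0)) (Tm (Var 1) (Var 1))" a b c d]
  by (simp add: basis_def S7_basis_def Let_def q_Pl q_Tm eval_nat_numeral)

lemma q_square_square: "q a \<otimes> q a \<otimes> (q a \<otimes> q a) = q a \<otimes> q a"
  using q_instance[of "Tm (Tm (Var 0) (Var 0)) (Tm (Var 0) (Var 0))" "Tm (Var 0) (Var 0)" a b c d]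
  by (simp add: basis_def S7_basis_def Let_def q_Pl q_Tm eval_nat_numeral)

lemma q_loop: "q a \<oplus> q a \<otimes> q b = q a \<oplus> q a \<otimes> q b \<oplus> q a \<otimes> q b \<otimes> q b"
  using q_instance[of "Pl (Var 0) (Tm (Var 0) (Var 1))" "Pl (Pl (Var 0) (Tm (Var 0) (Var 1))) (Tm (Tm (Var 0) (Var 1)) (Var 1))" a b c d]
  by (simp add: basis_def S7_basis_def Let_def q_Pl q_Tm eval_nat_numeral)

lemma q_path: "q a \<otimes> q b \<oplus> (q b \<otimes> q c \<oplus> q c \<otimes> q d) =
      q a \<otimes> q b \<oplus> (q b \<otimes> q c \<oplus> q c \<otimes> q d) \<oplus> q a \<otimes> q d"
  using q_instance[of "Pl (Tm (Var 0) (Var 1)) (Pl (Tm (Var 1) (Var 2)) (Tm (Var 2) (Var 3)))" "Pl (Pl (Tm (Var 0) (Var 1)) (Pl (Tm (Var 1) (Var 2)) (Tm (Var 2) (Var 3)))) (Tm (Var 0) (Var 3))" a b c d]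
  by (simp add: basis_def S7_basis_def Let_def q_Pl q_Tm eval_nat_numeral)

lemma q_cube: "q a \<otimes> q b \<otimes> q c = q a \<otimes> q b \<otimes> q c \<otimes> (q a \<otimes> q b \<otimes> q c)"
  using q_instance[of "Tm (Tm (Var 0) (Var 1)) (Var 2)" "Tm (Tm (Tm (Var 0) (Var 1)) (Var 2)) (Tm (Tm (Var 0) (Var 1)) (Var 2))" a b c d]
  by (simp add: basis_def S7_basis_def Let_def q_Pl q_Tm eval_nat_numeral)

lemma padd_rep: "q (rep X) \<oplus> Y = X \<oplus> Y" "X \<oplus> q (rep Y) = X \<oplus> Y"
  using padd_q[of "q (rep X)" Y] padd_q[of X "q (rep Y)"] padd_q[of X Y] by (simp_all add: q_rep)

lemma pmul_rep: "q (rep X) \<otimes> Y = X \<otimes> Y" "X \<otimes> q (rep Y) = X \<otimes> Y"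
  using pmul_q[of "q (rep X)" Y] pmul_q[of X "q (rep Y)"] pmul_q[of X Y] by (simp_all add: q_rep)

sublocale add: abel_semigroup padd
proof
  fix X Y Z
  show "X \<oplus> Y = Y \<oplus> X"
    using q_add_commute[of "rep X" "rep Y"] by (simp add: padd_rep)
  show "X \<oplus> Y \<oplus> Z = X \<oplus> (Y \<oplus> Z)"
    using q_add_assoc[of "rep X" "rep Y" "rep Z"] by (simp add: padd_rep)
qed

sublocale mul: abel_semigroup pmul
proof
  fix X Y Z
  show "X \<otimes> Y = Y \<otimes> X"
    using q_mul_commute[of "rep X" "rep Y"] by (simp add: pmul_rep)
  show "X \<otimes> Y \<otimes> Z = X \<otimes> (Y \<otimes> Z)"
    using q_mul_assoc[of "rep X" "rep Y" "rep Z"] by (simp add: pmul_rep)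
qed

lemma q_distrib_right: "(q b \<oplus> q c) \<otimes> q a = q b \<otimes> q a \<oplus> q c \<otimes> q a"
  using q_distrib[of a b c] by (simp add: mul.commute)

lemmas add_ac = add.commute add.left_commute add.assoc
lemmas mul_ac = mul.commute mul.left_commute mul.assoc

section \<open>Squares, absorption and degenerate terms\<close>

abbreviation sq :: "trm \<Rightarrow> trm set" where "sq t \<equiv> q t \<otimes> q t"

definition absorbs :: "trm \<Rightarrow> trm \<Rightarrow> bool" where
  "absorbs s u \<longleftrightarrow> q s \<oplus> q u = q s"

text \<open>By \<open>sq_cong_vars\<close>, the class of such a term depends on its variables
  only.\<close>

definition degenerate :: "trm \<Rightarrow> bool" where
  "degenerate s \<longleftrightarrow> sq s = q s"

lemma sq_Tm: "sq (Tm s t) = sq s \<otimes> sq t"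
  by (simp add: q_Tm mul_ac)

lemma sq_add_sq: "sq s \<oplus> sq t = sq s \<otimes> sq t"
proof -
  have "sq s \<oplus> q (Tm t t) = sq s \<otimes> sq (Tm t t)" by (rule q_square_add)
  then show ?thesis by (simp add: q_Tm q_square_square)
qed

text \<open>Expanding leaves the two squares and the mixed product. The squares add up to the square
  of the mixed product, which absorbs that product by \<open>q_square_add\<close> and
  \<open>q_square_square\<close>.\<close>

lemma sq_Pl: "sq (Pl s t) = sq s \<otimes> sq t"
proof -
  have "sq (Pl s t) = q s \<otimes> q s \<oplus> q s \<otimes> q t \<oplus> (q t \<otimes> q s \<oplus> q t \<otimes> q t)"
    using q_distrib[of "Pl s t" s t] q_distrib_right[of s t s] q_distrib_right[of s t t]
    by (simp add: q_Pl mul.commute[of "q t" "q s"] add_ac)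
  also have "\<dots> = sq s \<oplus> sq t \<oplus> (q (Tm s t) \<oplus> q (Tm s t))"
    by (simp add: q_Tm mul.commute[of "q t" "q s"] add_ac)
  also have "\<dots> = sq (Tm s t) \<oplus> q (Tm s t)"
    by (simp only: q_add_idem sq_add_sq sq_Tm)
  also have "\<dots> = sq (Tm s t)"
    by (simp only: q_square_add q_square_square)
  finally show ?thesis by (simp add: sq_Tm)
qed

lemma sq_Var: "v \<in> vars s \<Longrightarrow> sq s \<otimes> sq (Var v) = sq s"
proof (induction s)
  case (Pl s t)
  have "sq s \<otimes> sq t \<otimes> sq (Var v) = sq s \<otimes> sq (Var v) \<otimes> sq t" by (simp only: mul_ac)
  with Pl show ?case using mul.assoc[of "sq s" "sq t" "sq (Var v)"] by (auto simp: sq_Pl)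
next
  case (Tm s t)
  have "sq s \<otimes> sq t \<otimes> sq (Var v) = sq s \<otimes> sq (Var v) \<otimes> sq t" by (simp only: mul_ac)
  with Tm show ?case using mul.assoc[of "sq s" "sq t" "sq (Var v)"] by (auto simp: sq_Tm)
qed (simp add: q_square_square)

lemma sq_vars: "vars t \<subseteq> vars s \<Longrightarrow> sq s \<otimes> sq t = sq s"
proof (induction t)
  case (Pl t u)
  then have "sq s \<otimes> (sq t \<otimes> sq u) = sq s" using mul.assoc[of "sq s" "sq t" "sq u"] by simp
  then show ?case by (simp add: sq_Pl)
next
  case (Tm t u)
  then have "sq s \<otimes> (sq t \<otimes> sq u) = sq s" using mul.assoc[of "sq s" "sq t" "sq u"] by simp
  then show ?case by (simp add: sq_Tm)
qed (simp add: sq_Var)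

lemma sq_cong_vars: "vars s = vars t \<Longrightarrow> sq s = sq t"
  using sq_vars[of s t] sq_vars[of t s] by (simp add: mul.commute)

lemma absorbs_refl: "absorbs s s"
  by (simp add: absorbs_def q_add_idem)

lemma absorbs_cong: "q u = q v \<Longrightarrow> absorbs s u \<longleftrightarrow> absorbs s v"
  by (simp add: absorbs_def)

lemma absorbs_trans: "absorbs s u \<Longrightarrow> absorbs u v \<Longrightarrow> absorbs s v"
  unfolding absorbs_def using add.assoc[of "q s" "q u" "q v"] by simp

lemma absorbs_Pl: "absorbs s (Pl u v) \<longleftrightarrow> absorbs s u \<and> absorbs s v"
proof
  assume a: "absorbs s (Pl u v)"
  have "absorbs (Pl u v) u"
    using q_add_idem[of u] by (simp add: absorbs_def q_Pl add_ac) (metis add.assoc)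
  moreover have "absorbs (Pl u v) v"
    using q_add_idem[of v] by (simp add: absorbs_def q_Pl add.assoc)
  ultimately show "absorbs s u \<and> absorbs s v" using a absorbs_trans by blast
next
  assume "absorbs s u \<and> absorbs s v"
  then show "absorbs s (Pl u v)"
    by (simp add: absorbs_def q_Pl flip: add.assoc)
qed

lemma absorbs_Tm: "absorbs u m \<Longrightarrow> absorbs v n \<Longrightarrow> absorbs (Tm u v) (Tm m n)"
proof -
  assume "absorbs u m" "absorbs v n"
  then have e: "q u = q u \<oplus> q m" "q v = q v \<oplus> q n" by (simp_all add: absorbs_def)
  have "q (Tm u v) = q (Pl u m) \<otimes> (q v \<oplus> q n)"
    using e by (simp add: q_Pl q_Tm)
  also have "\<dots> = q (Pl u m) \<otimes> q v \<oplus> q (Pl u m) \<otimes> q n"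
    by (rule q_distrib)
  also have "\<dots> = q (Tm u v) \<oplus> q (Tm m v) \<oplus> (q (Tm u n) \<oplus> q (Tm m n))"
    by (simp add: q_Pl q_Tm q_distrib_right)
  finally have "q (Tm u v) = q (Tm u v) \<oplus> q (Tm m v) \<oplus> q (Tm u n) \<oplus> q (Tm m n)"
    by (simp add: add.assoc)
  then show ?thesis
    unfolding absorbs_def using q_add_idem[of "Tm m n"] by (metis add.assoc)
qed

text \<open>The axiom \<open>x^2 + y = x^2 y^2\<close> rewrites \<open>s\<close> as a product of
  squares, which is idempotent.\<close>

lemma degenerateI: "absorbs s (Tm u u) \<Longrightarrow> degenerate s"
proof -
  assume "absorbs s (Tm u u)"
  then have "q s = sq u \<oplus> q s" by (simp add: absorbs_def q_Tm add.commute)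
  then have s: "q s = sq u \<otimes> sq s" by (simp add: q_square_add)
  have "sq s = (sq u \<otimes> sq u) \<otimes> (sq s \<otimes> sq s)"
    by (subst (1 2) s) (simp only: mul_ac)
  also have "\<dots> = q s" by (simp add: q_square_square flip: s)
  finally show ?thesis by (simp add: degenerate_def)
qed

lemma degenerateI': "absorbs s u \<Longrightarrow> q u = sq v \<Longrightarrow> degenerate s"
  using degenerateI[of s v] absorbs_cong[of u "Tm v v" s] by (simp add: q_Tm)

lemma absorbs_monomial: "m \<in> monomials t \<Longrightarrow> absorbs t m"
proof (induction t arbitrary: m)
  case (Pl s t)
  have "absorbs (Pl s t) s" "absorbs (Pl s t) t"
    using absorbs_Pl[of "Pl s t" s t] absorbs_refl by auto
  with Pl show ?case by (auto intro: absorbs_trans)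
next
  case (Tm s t)
  then show ?case by (auto intro: absorbs_Tm)
qed (simp add: absorbs_refl)

text \<open>The context \<open>c\<close> is general so that, for a product, one factor can move into
  it while the other is expanded.\<close>

lemma absorbs_Tm_monomials:
  "(\<And>m. m \<in> monomials t \<Longrightarrow> absorbs s (Tm m c)) \<Longrightarrow> absorbs s (Tm t c)"
proof (induction t arbitrary: c)
  case (Pl t u)
  then have "absorbs s (Pl (Tm t c) (Tm u c))" by (simp add: absorbs_Pl)
  then show ?case
    by (subst absorbs_cong[of _ "Pl (Tm t c) (Tm u c)"]) (simp_all add: q_Pl q_Tm q_distrib_right)
next
  case (Tm t u)
  have "absorbs s (Tm u (Tm t c))"
  proof (rule Tm.IH(2))
    fix n assume n: "n \<in> monomials u"
    have "absorbs s (Tm t (Tm n c))"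
    proof (rule Tm.IH(1))
      fix m assume "m \<in> monomials t"
      with n Tm.prems have "absorbs s (Tm (Tm m n) c)" by auto
      then show "absorbs s (Tm m (Tm n c))"
        by (subst absorbs_cong[of _ "Tm (Tm m n) c"]) (simp_all add: q_Tm mul_ac)
    qed
    then show "absorbs s (Tm n (Tm t c))"
      by (subst absorbs_cong[of _ "Tm t (Tm n c)"]) (simp_all add: q_Tm mul_ac)
  qed
  then show ?case
    by (subst absorbs_cong[of _ "Tm u (Tm t c)"]) (simp_all add: q_Tm mul_ac)
qed simp

lemma absorbs_if_monomials:
  "(\<And>m. m \<in> monomials t \<Longrightarrow> absorbs s m) \<Longrightarrow> absorbs s t"
proof (induction t)
  case (Tm t u)
  show ?case
  proof (rule absorbs_Tm_monomials)
    fix m assume m: "m \<in> monomials t"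
    have "absorbs s (Tm u m)"
    proof (rule absorbs_Tm_monomials)
      fix n assume "n \<in> monomials u"
      with m Tm.prems have "absorbs s (Tm m n)" by auto
      then show "absorbs s (Tm n m)"
        by (subst absorbs_cong[of _ "Tm m n"]) (simp_all add: q_Tm mul.commute)
    qed
    then show "absorbs s (Tm m u)"
      by (subst absorbs_cong[of _ "Tm u m"]) (simp_all add: q_Tm mul.commute)
  qed
qed (simp_all add: absorbs_Pl)

text \<open>A product of three factors is its own square, and absorbing a square makes
  \<open>s\<close> degenerate.\<close>

lemma monomial_degree_le_2:
  assumes "\<not> degenerate s" and "absorbs s m" and "m \<in> monomials t"
  obtains x where "m = Var x" | x y where "m = Tm (Var x) (Var y)"
proof -
  have cube: "\<not> absorbs s u" if "q u = q a \<otimes> q b \<otimes> q c" for u a b c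
    using degenerateI'[of s u "Tm (Tm a b) c"] q_cube[of a b c] that assms(1) by (auto simp: q_Tm)
  show thesis
  proof (cases m)
    case (Var x)
    then show ?thesis by (rule that)
  next
    case (Pl u v)
    then show ?thesis using no_Pl_monomial[OF assms(3)] by simp
  next
    case (Tm u v)
    have "m \<noteq> Tm u (Tm a b)" "m \<noteq> Tm (Tm a b) v" for a b
      using cube[of m u a b] cube[of m a b v] assms(2) by (auto simp: q_Tm mul.assoc)
    moreover have "m \<noteq> Tm u (Pl a b)" "m \<noteq> Tm (Pl a b) v" for a b
      using no_Pl_monomial[OF assms(3)] by auto
    ultimately show ?thesis using Tm that by (cases u; cases v) auto
  qed
qed

end

section \<open>Deriving the identities of \<open>IdS k\<close> for \<open>k\<close> at most
  2\<close>

context basis_theory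
begin

text \<open>The variables and edges absorbed by \<open>s\<close> form a graph. Every proper
  2-colouring of it gives \<open>s\<close>, hence every monomial of \<open>t\<close>, the value
  \<open>{..<k}\<close>. A monomial of \<open>t\<close> that is not absorbed would lose this value
  under some proper colouring.\<close>

lemma absorbs_if_identity:
  assumes nd: "\<not> degenerate s" and st: "(s, t) \<in> IdS k" and k: "k \<le> 2"
    and nil: "(linear_word (Suc k), Tm (linear_word (Suc k)) (linear_word (Suc k))) \<in> T"
  shows "absorbs s t"
proof -
  have word_deg: "q u \<noteq> sq v" if "absorbs s u" for u v
    using that degenerateI' nd by blast
  have k0: "k \<noteq> 0"
  proof
    assume "k = 0"
    with eq_theory_subst[OF T nil, of "\<lambda>_. s"] have "(s, Tm s s) \<in> T" by simp
    then have "q s = sq s" by (simp flip: q_eq add: q_Tm)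
    then show False using nd by (simp add: degenerate_def)
  qed
  define L where "L x \<longleftrightarrow> absorbs s (Var x)" for x
  define E where "E x y \<longleftrightarrow> absorbs s (Tm (Var x) (Var y))" for x y
  have Esym: "E x y \<Longrightarrow> E y x" for x y
    unfolding E_def using absorbs_cong[of "Tm (Var x) (Var y)" "Tm (Var y) (Var x)" s]
    by (simp add: q_Tm mul.commute)
  have Eirrefl: "\<not> E x x" for x
    unfolding E_def using nd degenerateI by blast
  have Eclosed: "E x w" if "E x y" "E y z" "E z w" for x y z w
  proof -
    have "absorbs s (Pl (Tm (Var x) (Var y)) (Pl (Tm (Var y) (Var z)) (Tm (Var z) (Var w))))"
      using that by (simp add: absorbs_Pl E_def)
    moreover have "absorbs (Pl (Tm (Var x) (Var y)) (Pl (Tm (Var y) (Var z)) (Tm (Var z) (Var w))))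
        (Tm (Var x) (Var w))"
      unfolding absorbs_def q_Pl q_Tm by (rule q_path[symmetric])
    ultimately show ?thesis unfolding E_def by (rule absorbs_trans)
  qed
  \<comment> \<open>Together, \<open>x\<close> and \<open>xy\<close> would yield the summand
    \<open>xyy\<close> of degree three.\<close>
  have LE: "\<not> E x y" if "L x" for x y
  proof
    assume "E x y"
    then have "absorbs s (Pl (Var x) (Tm (Var x) (Var y)))"
      using that by (simp add: absorbs_Pl E_def L_def)
    moreover have "absorbs (Pl (Var x) (Tm (Var x) (Var y))) (Tm (Tm (Var x) (Var y)) (Var y))"
      unfolding absorbs_def q_Pl q_Tm by (rule q_loop[symmetric])
    ultimately have "absorbs s (Tm (Tm (Var x) (Var y)) (Var y))" by (rule absorbs_trans)
    moreover have "q (Tm (Tm (Var x) (Var y)) (Var y)) = sq (Tm (Tm (Var x) (Var y)) (Var y))"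
      unfolding q_Tm by (rule q_cube)
    ultimately show False using word_deg by blast
  qed
  have Ek: "k = 2" if "E x y" for x y
  proof (rule ccontr)
    assume "k \<noteq> 2"
    then have "k = 1" using k k0 by simp
    with eq_theory_subst[OF T nil, of "\<lambda>i. if i = 0 then Var x else Var y"]
    have "(Tm (Var x) (Var y), Tm (Tm (Var x) (Var y)) (Tm (Var x) (Var y))) \<in> T"
      by simp
    then have "q (Tm (Var x) (Var y)) = sq (Tm (Var x) (Var y))"
      by (simp flip: q_eq add: q_Tm)
    then show False using word_deg that by (simp add: E_def)
  qed
  \<comment> \<open>Absorbed variables get the full word, ends of edges single letters, and all
    other variables zero.\<close>
  define \<sigma> where "\<sigma> c x = (if L x then {..<k} else if \<exists>y. E x y then (if c x then {0} else {1}) else {})"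
    for c :: "nat \<Rightarrow> bool" and x
  have \<sigma>E: "\<sigma> c x = (if c x then {0} else {1})" if "E x y" for c x y
    using that LE by (auto simp: \<sigma>_def)
  define proper where "proper c \<longleftrightarrow> (\<forall>x y. E x y \<longrightarrow> c x \<noteq> c y)" for c :: "nat \<Rightarrow> bool"
  have val: "evd (\<sigma> c) m = {..<k}"
    if m: "m \<in> monomials t" and c: "proper c" for m c
  proof -
    have "evd (\<sigma> c) s = {..<k}"
    proof (rule evd_if_monomials)
      show "{..<k} \<noteq> {}" using k0 by auto
      fix m assume m: "m \<in> monomials s"
      then have abs: "absorbs s m" by (rule absorbs_monomial)
      from nd abs m show "evd (\<sigma> c) m = {..<k}"
      proof (cases rule: monomial_degree_le_2)
        case (1 x)
        then show ?thesis using abs by (simp add: \<sigma>_def L_def)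
      next
        case (2 x y)
        then have xy: "E x y" using abs by (simp add: E_def)
        have "{..<2::nat} = {0, 1}" by auto
        then show ?thesis
          using 2 \<sigma>E[OF xy, of c] \<sigma>E[OF Esym[OF xy], of c] c Ek[OF xy] xy
          by (auto simp: dmul_disjoint proper_def)
      qed
    qed
    moreover have "\<sigma> c i \<in> Pow {..<k}" for i
      using Ek by (auto simp: \<sigma>_def)
    ultimately have "evd (\<sigma> c) t = {..<k}"
      using IdsD[OF st[unfolded IdS_def], of "\<sigma> c"] by simp
    then show ?thesis using evd_monomial[OF _ m, of "\<sigma> c"] k0 by (simp add: lessThan_empty_iff)
  qed
  have colouring: "\<exists>c. proper c \<and> c a = c b" if "\<not> E a b" for a b
    unfolding proper_def by (rule two_colouring[of E a b, OF Esym Eirrefl Eclosed that])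
  obtain c0 where c0: "proper c0"
    using colouring[OF Eirrefl[of 0]] by blast
  have fin: "finite (evd (\<sigma> c) u)" if "evd (\<sigma> c) u \<noteq> {}" for c u
  proof -
    have "\<sigma> c i \<subseteq> {..<2}" for i using k by (simp add: \<sigma>_def)
    then have "evd (\<sigma> c) u \<in> Pow {..<2}" by (intro evd_in) simp
    then show ?thesis using finite_subset[of "evd (\<sigma> c) u" "{..<2}"] by simp
  qed
  have card_Tm: "card (evd (\<sigma> c) u) + card (evd (\<sigma> c) v) = card (evd (\<sigma> c) (Tm u v)) \<and>
      card (evd (\<sigma> c) u) \<ge> 1 \<and> card (evd (\<sigma> c) v) \<ge> 1" if "evd (\<sigma> c) (Tm u v) \<noteq> {}" for c u v
  proof -
    have ne: "evd (\<sigma> c) u \<noteq> {}" "evd (\<sigma> c) v \<noteq> {}" "evd (\<sigma> c) u \<inter> evd (\<sigma> c) v = {}"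
      using dmul_nonempty[of "evd (\<sigma> c) u" "evd (\<sigma> c) v"] that by simp_all
    then show ?thesis
      using fin[OF ne(1)] fin[OF ne(2)]
      by (simp add: dmul_disjoint card_Un_disjoint Suc_le_eq card_gt_0_iff)
  qed
  show ?thesis
  proof (rule absorbs_if_monomials)
    fix m assume m: "m \<in> monomials t"
    show "absorbs s m"
    proof (cases m)
      case (Var x)
      then have "\<sigma> c0 x = {..<k}" using val[OF m c0] by simp
      moreover have "\<sigma> c0 x \<noteq> {..<k}" if "E x y" for y
      proof
        assume "\<sigma> c0 x = {..<k}"
        then have "card (\<sigma> c0 x) = 2" using Ek[OF that] by simp
        then show False by (simp add: \<sigma>E[OF that] split: if_splits)
      qed
      moreover have "{..<k} \<noteq> {}" using k0 by (simp add: lessThan_empty_iff)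
      ultimately have "L x" by (metis \<sigma>_def)
      then show ?thesis by (simp add: L_def Var)
    next
      case (Pl u v)
      then show ?thesis using no_Pl_monomial[OF m] by simp
    next
      case (Tm u v)
      have ne: "evd (\<sigma> c) (Tm u v) \<noteq> {} \<and> card (evd (\<sigma> c) (Tm u v)) = k"
        if "proper c" for c
        using val[OF m that] Tm k0 by (simp add: lessThan_empty_iff)
      have k2: "k = 2" and card1: "card (evd (\<sigma> c) u) = 1" "card (evd (\<sigma> c) v) = 1"
        if "proper c" for c
        using card_Tm[of c u v] ne[OF that] k by linarith+
      \<comment> \<open>The value of a nonzero product has at least two elements, so a factor whose
        value is a singleton is a variable.\<close>
      have atom: "\<exists>x. u' = Var x" if "u' = u \<or> u' = v" for u'
      proof (cases u')
        case (Tm a b)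
        have "card (evd (\<sigma> c0) u') = 1" using that card1[OF c0] by blast
        moreover from this have "evd (\<sigma> c0) u' \<noteq> {}" by force
        ultimately have "1 + 1 \<le> (1::nat)" using card_Tm[of c0 a b] unfolding Tm by linarith
        then show ?thesis by simp
      next
        case (Pl a b)
        then show ?thesis using no_Pl_monomial[OF m] that \<open>m = Tm u v\<close> by auto
      qed simp
      then obtain x y where uv: "u = Var x" "v = Var y" by blast
      have "E x y"
      proof (rule ccontr)
        assume nE: "\<not> E x y"
        obtain c where c: "proper c" "c x = c y"
          using colouring[OF nE] by blast
        have "card (\<sigma> c x) = 1" "card (\<sigma> c y) = 1"
          using card1[OF c(1)] uv by simp_all
        then have "\<sigma> c x = (if c x then {0} else {1})" "\<sigma> c y = (if c y then {0} else {1})"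
          using k2[OF c0] by (auto simp: \<sigma>_def split: if_splits)
        then have "\<sigma> c x \<inter> \<sigma> c y \<noteq> {}" using c(2) by simp
        moreover have "dmul (\<sigma> c x) (\<sigma> c y) \<noteq> {}" using ne[OF c(1)] uv by simp
        ultimately show False using dmul_nonempty by blast
      qed
      then show ?thesis by (simp add: E_def Tm uv)
    qed
  qed
qed

text \<open>Absorbing a degenerate term makes a term degenerate, so both sides are degenerate or
  neither is. Either they equal their squares, or they absorb each other.\<close>

lemma identity_in_theory:
  assumes st: "(s, t) \<in> IdS k" and k: "k \<le> 2"
    and nil: "(linear_word (Suc k), Tm (linear_word (Suc k)) (linear_word (Suc k))) \<in> T"
    and sq: "sq s = sq t"
  shows "(s, t) \<in> T"
proof -
  have ts: "(t, s) \<in> IdS k" by (rule eq_theory_sym[OF eq_theory_IdS st])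
  have one: "degenerate u" if uv: "(u, v) \<in> IdS k" and v: "degenerate v" for u v
  proof (rule ccontr)
    assume "\<not> degenerate u"
    from absorbs_if_identity[OF this uv k nil] have "absorbs u v" .
    from degenerateI'[OF this, of v] v show False
      using \<open>\<not> degenerate u\<close> by (simp add: degenerate_def)
  qed
  show ?thesis
  proof (cases "degenerate s")
    case True
    then have "degenerate t" using one[OF ts] by simp
    with True sq show ?thesis by (simp add: degenerate_def flip: q_eq)
  next
    case False
    then have "\<not> degenerate t" using one[OF st] by blast
    from absorbs_if_identity[OF False st k nil] absorbs_if_identity[OF this ts k nil]
    show ?thesis by (simp add: absorbs_def add.commute flip: q_eq)
  qed
qed

end

text \<open>Setting one variable to \<open>Inf\<close> and all others to \<open>One\<close> detects
  whether it occurs.\<close>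

lemma vars_eq_if_Id_M2: "(s, t) \<in> Id_M2 \<Longrightarrow> vars s = vars t"
proof -
  have val: "ev7 (\<lambda>i. if i = x then Inf else One) u = (if x \<in> vars u then Inf else One)" for x u
    by (induction u) (auto simp: mulS_def fadd_neq)
  assume st: "(s, t) \<in> Id_M2"
  have "x \<in> vars s \<longleftrightarrow> x \<in> vars t" for x
  proof -
    have "ev7 (\<lambda>i. if i = x then Inf else One) s = ev7 (\<lambda>i. if i = x then Inf else One) t"
      by (rule IdsD[OF st[unfolded Id_M2_eq]]) simp
    then show ?thesis by (auto simp: val split: if_splits)
  qed
  then show ?thesis by blast
qed

lemma Id_M2_Int_IdS_subset:
  assumes "eq_theory T" and "basis \<subseteq> T" and "k \<le> 2"
    and "(linear_word (Suc k), Tm (linear_word (Suc k)) (linear_word (Suc k))) \<in> T"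
  shows "Id_M2 \<inter> IdS k \<subseteq> T"
proof -
  interpret basis_theory T by unfold_locales (fact assms)+
  show ?thesis
  proof (rule subrelI)
    fix s t assume "(s, t) \<in> Id_M2 \<inter> IdS k"
    then show "(s, t) \<in> T"
      using identity_in_theory[OF _ assms(3,4)] sq_cong_vars[OF vars_eq_if_Id_M2] by blast
  qed
qed

lemma IdS_subset:
  assumes "eq_theory T" and "basis \<subseteq> T" and "k \<le> 2"
    and "(linear_word (Suc k), Tm (linear_word (Suc k)) (linear_word (Suc k))) \<in> T"
    and sq: "(Tm (Var 0) (Var 0), Tm (Var 1) (Var 1)) \<in> T"
  shows "IdS k \<subseteq> T"
proof -
  interpret basis_theory T by unfold_locales (fact assms)+
  \<comment> \<open>All squares coincide here, so the two sides may have different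
    variables.\<close>
  have "sq s = sq t" for s t
    using eq_theory_subst[OF T sq, of "\<lambda>i. if i = 0 then s else t"] by (simp flip: q_eq add: q_Tm)
  then show ?thesis
    using identity_in_theory[OF _ assms(3,4)] by (intro subrelI) blast
qed

lemma basis_subset:
  assumes "Id_S7 \<subseteq> T" and "eq_theory T" and "\<not> T \<subseteq> IdS 3"
  shows "basis \<subseteq> T"
proof -
  let ?x = "Var 0" and ?y = "Var 1" and ?z = "Var 2"
  have nil: "(Tm ?x (Tm ?y ?z), Tm (Tm ?x (Tm ?y ?z)) (Tm ?x (Tm ?y ?z))) \<in> T"
    using linear_word_nil[of T 3] assms by (simp add: upt_rec eval_nat_numeral)
  have assoc: "(Tm (Tm ?x ?y) ?z, Tm ?x (Tm ?y ?z)) \<in> T"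
    using Id_S7I[of "Tm (Tm ?x ?y) ?z" "Tm ?x (Tm ?y ?z)"] assms(1) by (auto simp: S7_mult.assoc)
  have cube: "(Tm (Tm ?x ?y) ?z, Tm (Tm (Tm ?x ?y) ?z) (Tm (Tm ?x ?y) ?z)) \<in> T"
    using eq_theory_trans[OF assms(2) assoc eq_theory_trans[OF assms(2) nil
        eq_theory_sym[OF assms(2) eq_theory_Tm[OF assms(2) assoc assoc]]]] .
  have laws:
    "fadd a b = fadd b a" "fadd (fadd a b) c = fadd a (fadd b c)"
    "mulS a (fadd b c) = fadd (mulS a b) (mulS a c)"
    "fadd (mulS a a) b = mulS (mulS a a) (mulS b b)"
    "mulS (mulS a a) (mulS a a) = mulS a a"
    "fadd a (mulS a b) = fadd (fadd a (mulS a b)) (mulS (mulS a b) b)"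
    "fadd (mulS a b) (fadd (mulS b c) (mulS c d)) =
      fadd (fadd (mulS a b) (fadd (mulS b c) (mulS c d))) (mulS a d)"
    if "a \<in> car7" "b \<in> car7" "c \<in> car7" "d \<in> car7" for a b c d
    using that by (elim insertE emptyE; simp add: fadd_def mulS_def)+
  have "(s, t) \<in> Id_S7" if "(s, t) \<in> S7_basis" for s t
  proof (rule Id_S7I)
    fix \<sigma> :: "nat \<Rightarrow> el" assume "\<forall>i. \<sigma> i \<in> car7"
    then have "\<sigma> 0 \<in> car7" "\<sigma> 1 \<in> car7" "\<sigma> 2 \<in> car7" "\<sigma> 3 \<in> car7" by blast+
    note laws = laws[OF this]
    from that show "ev7 \<sigma> s = ev7 \<sigma> t"
      unfolding S7_basis_def Let_def
      by (elim insertE emptyE Pair_inject; hypsubst_thin; simp only: ev.simps fadd_idem;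
          (intro laws S7_mult.commute S7_mult.assoc)?)
  qed
  then have "S7_basis \<subseteq> T" using assms(1) by (intro subrelI) blast
  with cube show ?thesis by (simp add: basis_def Let_def)
qed

section \<open>Sparse hypergraphs\<close>

text \<open>The bipartite incidence graph of the hypergraph has two copies of \<open>\<Omega>\<close> as its sides;
  an edge of colour \<open>c < 3\<close> joins the hyperedge \<open>e\<close> to the vertex \<open>p c e\<close>. The last condition
  says that this graph has no short cycles.\<close>
definition involution_system :: "'a set \<Rightarrow> (nat \<Rightarrow> 'a \<Rightarrow> 'a) \<Rightarrow> nat \<Rightarrow> bool" where
  "involution_system \<Omega> p K \<longleftrightarrow>
    (\<exists>m. card \<Omega> = 2 ^ m) \<and>
    (\<forall>c<3. \<forall>x\<in>\<Omega>. p c x \<in> \<Omega> \<and> p c (p c x) = x) \<and>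
    (\<forall>x\<in>\<Omega>. \<forall>cs. cs \<noteq> [] \<and> length cs \<le> K \<and> set cs \<subseteq> {..<3} \<and> distinct_adj cs
      \<longrightarrow> fold p cs x \<noteq> x)"

lemma
  assumes "involution_system \<Omega> p K"
  shows involution_system_card: "\<exists>m. card \<Omega> = 2 ^ m"
    and involution_system_in: "c < 3 \<Longrightarrow> x \<in> \<Omega> \<Longrightarrow> p c x \<in> \<Omega>"
    and involution_system_invol: "c < 3 \<Longrightarrow> x \<in> \<Omega> \<Longrightarrow> p c (p c x) = x"
    and involution_system_girth: "x \<in> \<Omega> \<Longrightarrow> cs \<noteq> [] \<Longrightarrow> length cs \<le> K \<Longrightarrow> set cs \<subseteq> {..<3} \<Longrightarrow>
      distinct_adj cs \<Longrightarrow> fold p cs x \<noteq> x"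
  using assms by (simp_all add: involution_system_def)

lemma involution_system_fold_in:
  assumes "involution_system \<Omega> p K"
  shows "set cs \<subseteq> {..<3} \<Longrightarrow> x \<in> \<Omega> \<Longrightarrow> fold p cs x \<in> \<Omega>"
  by (induction cs arbitrary: x) (auto simp: involution_system_in[OF assms])

lemma involution_system_finite: "involution_system \<Omega> p K \<Longrightarrow> finite \<Omega>"
  using involution_system_card[of \<Omega> p K] card.infinite by (metis power_not_zero zero_neq_numeral)

text \<open>In the lift every edge of the incidence graph gets a bit that flips when the edge is
  traversed, so a closed walk traverses every edge an even number of times.\<close>
lemma involution_system_lift:
  fixes \<Omega> :: "nat set"
  assumes sys: "involution_system \<Omega> p K"
  defines "ed \<equiv> \<lambda>c x. (min x (p c x), c)"
  defines "p' \<equiv> \<lambda>c (x, F). (p c x, sym_diff F {ed c x})"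
  shows "involution_system (\<Omega> \<times> Pow (\<Omega> \<times> {..<3})) p' (Suc K)"
proof -
  note fin = involution_system_finite[OF sys] and pin = involution_system_in[OF sys]
    and invol = involution_system_invol[OF sys] and girth = involution_system_girth[OF sys]
  have p': "p' c (x, F) = (p c x, sym_diff F {ed c x})" for c x F by (simp add: p'_def)
  obtain m where m: "card \<Omega> = 2 ^ m" using involution_system_card[OF sys] by blast
  have "card (\<Omega> \<times> Pow (\<Omega> \<times> {..<3::nat})) = 2 ^ (m + 2 ^ m * 3)"
    using fin by (simp add: card_cartesian_product card_Pow m power_add)
  then have card: "\<exists>m. card (\<Omega> \<times> Pow (\<Omega> \<times> {..<3::nat})) = 2 ^ m" by blast
  have ed_in: "ed c x \<in> \<Omega> \<times> {..<3}" if "c < 3" "x \<in> \<Omega>" for c x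
    using pin[OF that] that by (simp add: ed_def min_def)
  have ed_p: "ed c (p c x) = ed c x" if "c < 3" "x \<in> \<Omega>" for c x
    using invol[OF that] by (simp add: ed_def min.commute)
  have ed_eq: "d = c \<and> (z = x \<or> z = p c x)" if "ed d z = ed c x" "c < 3" "x \<in> \<Omega>" "z \<in> \<Omega>" for c d x z
  proof -
    have "d = c" and mn: "min z (p c z) = min x (p c x)" using that(1) by (auto simp: ed_def)
    have "z = x \<or> z = p c x \<or> p c z = x \<or> p c z = p c x"
      using mn unfolding min_def by (auto split: if_splits)
    then show ?thesis using \<open>d = c\<close> invol[OF that(2,3)] invol[OF that(2,4)] by metis
  qed
  have fst_fold: "fst (fold p' cs (x, F)) = fold p cs x" for cs x F
    by (induction cs arbitrary: x F) (simp_all add: p')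
  \<comment> \<open>The bit of an edge changes only if the walk crosses that edge.\<close>
  have flip: "\<exists>us d vs. cs = us @ d # vs \<and> ed d (fold p us x) = \<epsilon>"
    if "\<epsilon> \<in> snd (fold p' cs (x, F)) \<longleftrightarrow> \<epsilon> \<notin> F" for cs x F \<epsilon>
    using that
  proof (induction cs arbitrary: x F)
    case (Cons c cs)
    show ?case
    proof (cases "ed c x = \<epsilon>")
      case True
      then have "c # cs = [] @ c # cs \<and> ed c (fold p [] x) = \<epsilon>" by simp
      then show ?thesis by blast
    next
      case False
      then have "\<epsilon> \<in> snd (fold p' cs (p c x, sym_diff F {ed c x})) \<longleftrightarrow> \<epsilon> \<notin> sym_diff F {ed c x}"
        using Cons.prems by (auto simp: p')
      from Cons.IH[OF this] obtain us d vs where "cs = us @ d # vs" "ed d (fold p us (p c x)) = \<epsilon>"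
        by blast
      then have "c # cs = (c # us) @ d # vs \<and> ed d (fold p (c # us) x) = \<epsilon>" by simp
      then show ?thesis by blast
    qed
  qed simp
  have nofix: "fold p' cs (x, F) \<noteq> (x, F)"
    if x: "x \<in> \<Omega>" and cs: "cs \<noteq> []" "length cs \<le> Suc K" "set cs \<subseteq> {..<3}" "distinct_adj cs" for cs x F
  proof
    assume closed: "fold p' cs (x, F) = (x, F)"
    then have fold_cs: "fold p cs x = x" using fst_fold[of cs x F] by simp
    obtain c ds where cds: "cs = c # ds" using cs(1) by (cases cs) auto
    have c: "c < 3" using cs(3) cds by simp
    define y where "y = p c x"
    have y: "y \<in> \<Omega>" using pin[OF c x] by (simp add: y_def)
    have "fold p' ds (y, sym_diff F {ed c x}) = (x, F)" using closed by (simp add: cds p' y_def)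
    \<comment> \<open>The first step has flipped the bit of its edge, so the rest of the closed walk
      must cross this edge again.\<close>
    then have "ed c x \<in> snd (fold p' ds (y, sym_diff F {ed c x})) \<longleftrightarrow> ed c x \<notin> sym_diff F {ed c x}"
      by auto
    from flip[OF this] obtain us d vs where ds: "ds = us @ d # vs" and e: "ed d (fold p us y) = ed c x"
      by blast
    have us: "set us \<subseteq> {..<3}" using cs(3) cds ds by auto
    have "fold p us y \<in> \<Omega>" by (rule involution_system_fold_in[OF sys us y])
    \<comment> \<open>Just before the second crossing the walk is at \<open>x\<close> or
      \<open>y\<close>. This closes a walk of length at most \<open>K\<close> in the original
      system, or is an immediate backtrack if \<open>us\<close> is empty.\<close>
    from ed_eq[OF e c x this] have d: "d = c" and z: "fold p us y = x \<or> fold p us y = y"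
      by (auto simp: y_def)
    have adj: "distinct_adj (c # us)"
      using cs(4) cds ds by (metis append_Cons distinct_adj_appendD1)
    have len: "length (c # us) \<le> K" using cs(2) cds ds by simp
    from z show False
    proof
      assume "fold p us y = x"
      then have "fold p (c # us) x = x" by (simp add: y_def)
      with girth[OF x _ len _ adj] us c show False by simp
    next
      assume zy: "fold p us y = y"
      show False
      proof (cases "us = []")
        case True
        then show False using cs(4) cds ds d by simp
      next
        case False
        have "distinct_adj us" using adj by (cases us) auto
        with girth[OF y False _ us] zy len show False by simp
      qed
    qed
  qed
  have invol': "p' c a \<in> \<Omega> \<times> Pow (\<Omega> \<times> {..<3}) \<and> p' c (p' c a) = a"
    if c: "c < 3" and "a \<in> \<Omega> \<times> Pow (\<Omega> \<times> {..<3})" for c a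
  proof -
    from \<open>a \<in> _\<close> obtain x F where a: "a = (x, F)" "x \<in> \<Omega>" "F \<subseteq> \<Omega> \<times> {..<3}" by auto
    have "sym_diff (sym_diff F {ed c x}) {ed c x} = F" by blast
    then have "p' c (p' c a) = a"
      by (simp only: a(1) p' ed_p[OF c a(2)] invol[OF c a(2)])
    moreover have "sym_diff F {ed c x} \<subseteq> \<Omega> \<times> {..<3}"
      using a(3) ed_in[OF c a(2)] by blast
    then have "p' c a \<in> \<Omega> \<times> Pow (\<Omega> \<times> {..<3})"
      using pin[OF c a(2)] by (simp only: a(1) p' mem_Times_iff fst_conv snd_conv Pow_iff simp_thms)
    ultimately show ?thesis by blast
  qed
  show ?thesis
    unfolding involution_system_def
  proof (intro conjI allI ballI impI)
    fix a :: "nat \<times> (nat \<times> nat) set" and cs :: "nat list"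
    assume "a \<in> \<Omega> \<times> Pow (\<Omega> \<times> {..<3})"
      and "cs \<noteq> [] \<and> length cs \<le> Suc K \<and> set cs \<subseteq> {..<3} \<and> distinct_adj cs"
    then show "fold p' cs a \<noteq> a"
      using nofix[of "fst a" cs "snd a"] by (simp add: mem_Times_iff)
  qed (use card invol' in blast)+
qed

text \<open>The lift lives on another type; renaming its finitely many points by numbers allows it
  to be iterated.\<close>

lemma involution_system_transport:
  assumes sys: "involution_system \<Omega> p K" and inj: "inj_on f \<Omega>"
  shows "involution_system (f ` \<Omega>) (\<lambda>c n. f (p c (inv_into \<Omega> f n))) K"
proof -
  let ?q = "\<lambda>c n. f (p c (inv_into \<Omega> f n))"
  have q: "?q c (f x) = f (p c x)" if "x \<in> \<Omega>" for c x
    using that inj by simp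
  have fold: "fold ?q cs (f x) = f (fold p cs x)" if "x \<in> \<Omega>" "set cs \<subseteq> {..<3}" for cs x
    using that
  proof (induction cs arbitrary: x)
    case (Cons c cs)
    then show ?case using q[of x c] involution_system_in[OF sys, of c x] by simp
  qed simp
  have "fold ?q cs (f x) \<noteq> f x"
    if "x \<in> \<Omega>" "cs \<noteq> []" "length cs \<le> K" "set cs \<subseteq> {..<3}" "distinct_adj cs" for cs x
    using involution_system_girth[OF sys that] fold[OF that(1,4)]
      involution_system_fold_in[OF sys that(4,1)] inj that(1) by (auto dest: inj_onD)
  moreover have "?q c (f x) \<in> f ` \<Omega> \<and> ?q c (?q c (f x)) = f x" if "c < 3" "x \<in> \<Omega>" for c x
    using q[OF that(2), of c] q[of "p c x" c] involution_system_in[OF sys that]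
      involution_system_invol[OF sys that] by simp
  moreover have "\<exists>m. card (f ` \<Omega>) = 2 ^ m"
    using involution_system_card[OF sys] inj by (simp add: card_image)
  ultimately show ?thesis unfolding involution_system_def by blast
qed

lemma involution_system_exists: "\<exists>(\<Omega> :: nat set) p. involution_system \<Omega> p K"
proof (induction K)
  case 0
  have "involution_system {0::nat} (\<lambda>_ x. x) 0"
    unfolding involution_system_def by (auto intro: exI[of _ 0])
  then show ?case by blast
next
  case (Suc K)
  then obtain \<Omega> :: "nat set" and p where "involution_system \<Omega> p K" by blast
  from involution_system_lift[OF this]
  obtain \<Omega>' :: "(nat \<times> (nat \<times> nat) set) set" and p' where sys: "involution_system \<Omega>' p' (Suc K)"
    by blast
  from finite_imp_inj_to_nat_seg[OF involution_system_finite[OF this]]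
  obtain f :: "nat \<times> (nat \<times> nat) set \<Rightarrow> nat" where "inj_on f \<Omega>'" by blast
  from involution_system_transport[OF sys this] show ?case by blast
qed

text \<open>A hyperedge of \<open>D\<close> with two vertices in other hyperedges of \<open>D\<close> can be left through either
  of them. If all hyperedges are of this kind, a walk that never backtracks revisits a hyperedge.\<close>
lemma involution_system_leaf:
  assumes sys: "involution_system \<Omega> p (2 * n)" and D: "D \<subseteq> \<Omega>" "D \<noteq> {}" "card D \<le> n"
  shows "\<exists>e\<in>D. \<exists>a. \<forall>f\<in>D - {e}. (\<lambda>c. p c e) ` {..<3} \<inter> (\<lambda>c. p c f) ` {..<3} \<subseteq> {a}"
proof (rule ccontr)
  assume no: "\<not> ?thesis"
  note pin = involution_system_in[OF sys] and invol = involution_system_invol[OF sys]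
  \<comment> \<open>Here \<open>d\<close> is the colour of the vertex through which \<open>e\<close>
    was entered. Taking this vertex for \<open>a\<close> yields an exit through a different
    one.\<close>
  have step: "\<exists>c f d'. c < 3 \<and> c \<noteq> d \<and> f \<in> D \<and> d' < 3 \<and> d' \<noteq> c \<and> f = p d' (p c e)"
    if e: "e \<in> D" for e d
  proof -
    from no e obtain f where f: "f \<in> D" "f \<noteq> e"
      "\<not> (\<lambda>c. p c e) ` {..<3} \<inter> (\<lambda>c. p c f) ` {..<3} \<subseteq> {p d e}"
      by blast
    then obtain v where v: "v \<in> (\<lambda>c. p c e) ` {..<3}" "v \<in> (\<lambda>c. p c f) ` {..<3}" "v \<noteq> p d e"
      by blast
    then obtain c d' where "c < 3" "v = p c e" "d' < 3" "v = p d' f" by auto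
    with v(3) have c: "c < 3" "d' < 3" "p c e = p d' f" "p c e \<noteq> p d e" by auto
    have "f \<in> \<Omega>" "e \<in> \<Omega>" using f e D by auto
    then have "f = p d' (p c e)" using invol[of d' f] c by simp
    moreover have "d' \<noteq> c" using c f \<open>f \<in> \<Omega>\<close> \<open>e \<in> \<Omega>\<close> invol by metis
    ultimately show ?thesis using c f by blast
  qed
  define g where "g s = (SOME (c, f, d'). c < 3 \<and> c \<noteq> snd s \<and> f \<in> D \<and> d' < 3 \<and> d' \<noteq> c \<and>
      f = p d' (p c (fst s)))" for s :: "'a \<times> nat"
  have g: "case g s of (c, f, d') \<Rightarrow> c < 3 \<and> c \<noteq> snd s \<and> f \<in> D \<and> d' < 3 \<and> d' \<noteq> c \<and>
      f = p d' (p c (fst s))" if "fst s \<in> D" for s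
  proof -
    from step[OF that, of "snd s"] have "\<exists>t. case t of (c, f, d') \<Rightarrow> c < 3 \<and> c \<noteq> snd s \<and> f \<in> D \<and>
      d' < 3 \<and> d' \<noteq> c \<and> f = p d' (p c (fst s))" by auto
    from someI_ex[OF this] show ?thesis unfolding g_def .
  qed
  obtain e0 where e0: "e0 \<in> D" using D by blast
  \<comment> \<open>A state is a hyperedge with the colour of its entry vertex; the initial colour
    is arbitrary.\<close>
  define s where "s = rec_nat (e0, 0::nat) (\<lambda>_ t. snd (g t))"
  have s0: "s 0 = (e0, 0)" and sS: "s (Suc i) = snd (g (s i))" for i
    by (simp_all add: s_def)
  define cc where "cc i = fst (g (s i))" for i
  have inD: "fst (s i) \<in> D" for i
  proof (induction i)
    case (Suc i)
    from g[OF this] show ?case by (auto simp: sS split: prod.splits)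
  qed (simp add: s0 e0)
  have st: "cc i < 3 \<and> cc i \<noteq> snd (s i) \<and> snd (s (Suc i)) < 3 \<and> snd (s (Suc i)) \<noteq> cc i \<and>
      fst (s (Suc i)) = p (snd (s (Suc i))) (p (cc i) (fst (s i)))" for i
    using g[OF inD[of i]] by (auto simp: sS cc_def split: prod.splits)
  define word where "word i l = concat (map (\<lambda>k. [cc k, snd (s (Suc k))]) [i..<i + l])" for i l
  have wS: "word i (Suc l) = word i l @ [cc (i + l), snd (s (Suc (i + l)))]" for i l
    by (simp add: word_def)
  have w: "fold p (word i l) (fst (s i)) = fst (s (i + l)) \<and> distinct_adj (word i l) \<and>
      (word i l \<noteq> [] \<longrightarrow> last (word i l) = snd (s (i + l))) \<and> set (word i l) \<subseteq> {..<3} \<and>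
      length (word i l) = 2 * l" for i l
  proof (induction l)
    case (Suc l)
    then show ?case using st[of "i + l"] by (auto simp: wS distinct_adj_append_iff)
  qed (simp add: word_def)
  have finD: "finite D" using D(1) involution_system_finite[OF sys] finite_subset by blast
  \<comment> \<open>There are \<open>n + 1\<close> states and at most \<open>n\<close> hyperedges.
    Each step spends two letters, whence the girth bound \<open>2 * n\<close>.\<close>
  have "\<not> inj_on (\<lambda>i. fst (s i)) {..n}"
  proof
    assume "inj_on (\<lambda>i. fst (s i)) {..n}"
    moreover have "(\<lambda>i. fst (s i)) ` {..n} \<subseteq> D" using inD by auto
    ultimately have "card {..n} \<le> card D" using card_inj_on_le finD by blast
    then show False using D(3) by simp
  qed
  then obtain i j where ij: "i < j" "j \<le> n" "fst (s i) = fst (s j)"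
    unfolding inj_on_def by (metis atMost_iff linorder_neqE_nat)
  define l where "l = j - i"
  have "fold p (word i l) (fst (s i)) = fst (s i)" using w[of i l] ij by (simp add: l_def)
  moreover have "length (word i l) \<le> 2 * n" "word i l \<noteq> []"
    using w[of i l] ij by (auto simp: l_def)
  ultimately show False
    using involution_system_girth[OF sys, of "fst (s i)" "word i l"] w[of i l] inD[of i] D(1) by blast
qed

section \<open>Rainbow colourings of acyclic hypergraphs\<close>

lemma third_colour: "\<exists>\<gamma><3. \<gamma> \<noteq> \<alpha> \<and> \<gamma> \<noteq> (\<beta>::nat)"
proof -
  have "\<not> {..<3} \<subseteq> {\<alpha>, \<beta>}"
  proof
    assume "{..<3} \<subseteq> {\<alpha>, \<beta>}"
    then have "card {..<3::nat} \<le> card {\<alpha>, \<beta>}" by (intro card_mono) auto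
    moreover have "card {\<alpha>, \<beta>} \<le> 2" by (simp add: card_insert_if)
    ultimately show False by simp
  qed
  then show ?thesis by blast
qed

text \<open>Removing a leaf \<open>e\<close> leaves two of its vertices unconstrained. A prescribed colour at one
  of them turns into a restriction on the colour of the third vertex \<open>a\<close>.\<close>
lemma rainbow_colouring:
  fixes V :: "'e \<Rightarrow> nat set"
  assumes "finite D" and "\<And>e. e \<in> D \<Longrightarrow> card (V e) = 3"
    and "\<And>D'. D' \<subseteq> D \<Longrightarrow> D' \<noteq> {} \<Longrightarrow> \<exists>e\<in>D'. \<exists>a. \<forall>f\<in>D' - {e}. V e \<inter> V f \<subseteq> {a}"
    and "x \<noteq> y" "\<alpha> < 3" "\<beta> < 3" "\<alpha> \<noteq> \<beta> \<or> (\<forall>e\<in>D. \<not> {x, y} \<subseteq> V e)"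
  shows "\<exists>col :: nat \<Rightarrow> nat. (\<forall>v. col v < 3) \<and> (\<forall>e\<in>D. inj_on col (V e)) \<and> col x = \<alpha> \<and> col y = \<beta>"
  using assms
proof (induction "card D" arbitrary: D x y \<alpha> \<beta>)
  case 0
  then have "D = {}" by simp
  then show ?case
    using 0 by (intro exI[of _ "\<lambda>v. if v = x then \<alpha> else \<beta>"]) auto
next
  case (Suc n)
  note finD = Suc.prems(1) and card3 = Suc.prems(2) and leaf = Suc.prems(3)
  have "D \<noteq> {}" using Suc.hyps(2) by auto
  then obtain e a0 where e: "e \<in> D" and a0: "\<And>f. f \<in> D - {e} \<Longrightarrow> V e \<inter> V f \<subseteq> {a0}"
    using leaf[of D] by blast
  define D' where "D' = D - {e}"
  have Ve: "card (V e) = 3" using card3 e by simp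
  \<comment> \<open>If \<open>a0\<close> is outside \<open>V e\<close>, then \<open>e\<close> meets
    no other hyperedge and any of its vertices can serve.\<close>
  obtain a where a: "a \<in> V e" and priv: "\<And>f. f \<in> D' \<Longrightarrow> V e \<inter> V f \<subseteq> {a}"
  proof (cases "a0 \<in> V e")
    case True
    then show ?thesis using that a0 by (simp add: D'_def)
  next
    case False
    obtain a where "a \<in> V e" using Ve by fastforce
    then show ?thesis using that[of a] False a0 by (fastforce simp: D'_def)
  qed
  have "card (V e - {a}) = 2" using Ve a by simp
  then obtain b c where bc: "V e - {a} = {b, c}" "b \<noteq> c" by (auto simp: card_2_iff)
  have abc: "V e = {a, b, c}" "a \<noteq> b" "a \<noteq> c" using bc a by auto
  have cardD': "n = card D'" using Suc.hyps(2) e finD by (simp add: D'_def)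
  have IH: "\<exists>col :: nat \<Rightarrow> nat. (\<forall>v. col v < 3) \<and> (\<forall>f\<in>D'. inj_on col (V f)) \<and> col u = \<gamma> \<and> col w = \<delta>"
    if "u \<noteq> w" "\<gamma> < 3" "\<delta> < 3" "\<gamma> \<noteq> \<delta> \<or> (\<forall>f\<in>D'. \<not> {u, w} \<subseteq> V f)" for u w and \<gamma> \<delta> :: nat
  proof (rule Suc.hyps(1)[OF cardD' _ _ _ that])
    fix D'' assume "D'' \<subseteq> D'" "D'' \<noteq> {}"
    then show "\<exists>e\<in>D''. \<exists>a. \<forall>f\<in>D'' - {e}. V e \<inter> V f \<subseteq> {a}"
      by (intro leaf) (auto simp: D'_def)
  qed (use finD card3 in \<open>auto simp: D'_def\<close>)
  have extend: "\<exists>col :: nat \<Rightarrow> nat. (\<forall>v. col v < 3) \<and> (\<forall>f\<in>D. inj_on col (V f)) \<and>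
      col = col'(b' := \<gamma>, c' := \<delta>)"
    if col': "\<forall>v. col' v < 3" "\<forall>f\<in>D'. inj_on col' (V f)" and lt: "\<gamma> < 3" "\<delta> < 3"
      and ne: "col' a \<noteq> \<gamma>" "col' a \<noteq> \<delta>" "\<gamma> \<noteq> \<delta>"
      and bc': "{b', c'} = {b, c}" "b' \<noteq> c'" for col' :: "nat \<Rightarrow> nat" and b' c' \<gamma> \<delta>
  proof -
    define col where "col = col'(b' := \<gamma>, c' := \<delta>)"
    have V: "V e = {a, b', c'}" "a \<noteq> b'" "a \<noteq> c'" using abc bc' by (auto simp: doubleton_eq_iff)
    have "inj_on col (V e)" using V bc'(2) ne by (auto simp: col_def inj_on_def)
    moreover have "inj_on col (V f)" if "f \<in> D'" for f
    proof -
      have "b' \<notin> V f" "c' \<notin> V f" using priv[OF that] V by auto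
      then have "\<And>v. v \<in> V f \<Longrightarrow> col v = col' v" by (auto simp: col_def)
      then show ?thesis using col'(2) that inj_on_cong by metis
    qed
    ultimately have "\<forall>f\<in>D. inj_on col (V f)" by (auto simp: D'_def)
    moreover have "\<forall>v. col v < 3" using col'(1) lt by (simp add: col_def)
    ultimately show ?thesis using col_def by blast
  qed
  have IH1: "\<exists>col :: nat \<Rightarrow> nat. (\<forall>v. col v < 3) \<and> (\<forall>f\<in>D'. inj_on col (V f)) \<and> col u = \<gamma>"
    if "\<gamma> < 3" for u and \<gamma> :: nat
  proof -
    obtain \<delta> where "\<delta> < 3" "\<delta> \<noteq> \<gamma>" using third_colour by blast
    then show ?thesis using IH[of u "Suc u" \<gamma> \<delta>] that by auto
  qed
  have one: "\<exists>col :: nat \<Rightarrow> nat. (\<forall>v. col v < 3) \<and> (\<forall>e\<in>D. inj_on col (V e)) \<and> col b' = \<gamma> \<and> col w = \<delta>"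
    if bc': "{b', c'} = {b, c}" "b' \<noteq> c'" and w: "w \<noteq> b'" "w \<noteq> c'"
      and lt: "\<gamma> < 3" "\<delta> < 3" and cond: "\<gamma> \<noteq> \<delta> \<or> (\<forall>e\<in>D. \<not> {b', w} \<subseteq> V e)" for b' c' w and \<gamma> \<delta> :: nat
  proof -
    \<comment> \<open>With \<open>b'\<close> coloured \<open>\<gamma>\<close>, it only matters that
      \<open>a\<close> avoids \<open>\<gamma>\<close>; then \<open>c'\<close> takes the remaining
      colour.\<close>
    have "\<exists>col' :: nat \<Rightarrow> nat. (\<forall>v. col' v < 3) \<and> (\<forall>f\<in>D'. inj_on col' (V f)) \<and> col' a \<noteq> \<gamma> \<and> col' w = \<delta>"
    proof (cases "w = a")
      case True
      have "{b', a} \<subseteq> V e" using abc bc'(1) by auto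
      then have "\<gamma> \<noteq> \<delta>" using cond True e by auto
      then show ?thesis using IH1[OF lt(2), of a] True by auto
    next
      case False
      obtain \<epsilon> where "\<epsilon> < 3" "\<epsilon> \<noteq> \<gamma>" "\<epsilon> \<noteq> \<delta>" using third_colour by blast
      then show ?thesis using IH[of a w \<epsilon> \<delta>] False lt by auto
    qed
    then obtain col' :: "nat \<Rightarrow> nat" where col': "\<forall>v. col' v < 3" "\<forall>f\<in>D'. inj_on col' (V f)" "col' a \<noteq> \<gamma>" "col' w = \<delta>"
      by blast
    obtain \<epsilon> where "\<epsilon> < 3" "\<epsilon> \<noteq> \<gamma>" "\<epsilon> \<noteq> col' a" using third_colour by blast
    then obtain col where col: "\<forall>v. col v < 3" "\<forall>f\<in>D. inj_on col (V f)" "col = col'(b' := \<gamma>, c' := \<epsilon>)"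
      using extend[OF col'(1,2) lt(1) _ col'(3) _ _ bc', of \<epsilon>] by blast
    have "col b' = \<gamma>" "col w = \<delta>" using w col'(4) bc'(2) by (simp_all add: col(3))
    with col(1,2) show ?thesis by blast
  qed
  have two: "\<exists>col :: nat \<Rightarrow> nat. (\<forall>v. col v < 3) \<and> (\<forall>e\<in>D. inj_on col (V e)) \<and> col b' = \<gamma> \<and> col c' = \<delta>"
    if bc': "{b', c'} = {b, c}" "b' \<noteq> c'"
      and lt: "\<gamma> < 3" "\<delta> < 3" and cond: "\<gamma> \<noteq> \<delta> \<or> (\<forall>e\<in>D. \<not> {b', c'} \<subseteq> V e)" for b' c' and \<gamma> \<delta> :: nat
  proof -
    have "{b', c'} \<subseteq> V e" using abc bc'(1) by auto
    then have "\<gamma> \<noteq> \<delta>" using cond e by auto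
    obtain \<epsilon> where "\<epsilon> < 3" "\<epsilon> \<noteq> \<gamma>" "\<epsilon> \<noteq> \<delta>" using third_colour by blast
    moreover from IH1[OF this(1), of a] obtain col' :: "nat \<Rightarrow> nat"
      where col': "\<forall>v. col' v < 3" "\<forall>f\<in>D'. inj_on col' (V f)" "col' a = \<epsilon>" by blast
    ultimately obtain col
      where col: "\<forall>v. col v < 3" "\<forall>f\<in>D. inj_on col (V f)" "col = col'(b' := \<gamma>, c' := \<delta>)"
      using extend[OF col'(1,2) lt _ _ \<open>\<gamma> \<noteq> \<delta>\<close> bc'] by blast
    have "col b' = \<gamma>" "col c' = \<delta>" using bc'(2) by (simp_all add: col(3))
    with col(1,2) show ?thesis by blast
  qed
  have partner: "\<exists>c'. {v, c'} = {b, c} \<and> v \<noteq> c'" if "v \<in> {b, c}" for v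
    using that bc(2) by (cases "v = b") (auto intro: exI[of _ c] exI[of _ b])
  note xy = Suc.prems(4) and lt = Suc.prems(5,6) and cond = Suc.prems(7)
  have cond': "\<beta> \<noteq> \<alpha> \<or> (\<forall>e\<in>D. \<not> {y, x} \<subseteq> V e)" using cond by auto
  show ?case
  proof (cases "x \<in> {b, c}"; cases "y \<in> {b, c}")
    assume x: "x \<in> {b, c}" and y: "y \<in> {b, c}"
    then have "{x, y} = {b, c}" using xy by auto
    from two[OF this xy lt cond] show ?thesis .
  next
    assume x: "x \<in> {b, c}" and y: "y \<notin> {b, c}"
    from partner[OF x] obtain c' where c': "{x, c'} = {b, c}" "x \<noteq> c'" by blast
    then have "y \<noteq> x" "y \<noteq> c'" using y by auto
    from one[OF c' this lt cond] show ?thesis .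
  next
    assume x: "x \<notin> {b, c}" and y: "y \<in> {b, c}"
    from partner[OF y] obtain c' where c': "{y, c'} = {b, c}" "y \<noteq> c'" by blast
    then have "x \<noteq> y" "x \<noteq> c'" using x by auto
    from one[OF c' this lt(2,1) cond'] show ?thesis by (elim exE conjE) (intro exI conjI)
  next
    assume x: "x \<notin> {b, c}" and y: "y \<notin> {b, c}"
    have "\<alpha> \<noteq> \<beta> \<or> (\<forall>f\<in>D'. \<not> {x, y} \<subseteq> V f)" using cond by (auto simp: D'_def)
    from IH[OF xy lt this] obtain col' :: "nat \<Rightarrow> nat"
      where col': "\<forall>v. col' v < 3" "\<forall>f\<in>D'. inj_on col' (V f)" "col' x = \<alpha>" "col' y = \<beta>" by blast
    obtain \<gamma> where \<gamma>: "\<gamma> < 3" "\<gamma> \<noteq> col' a" using third_colour by blast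
    obtain \<delta> where \<delta>: "\<delta> < 3" "\<delta> \<noteq> col' a" "\<delta> \<noteq> \<gamma>" using third_colour by blast
    from extend[OF col'(1,2) \<gamma>(1) \<delta>(1) \<gamma>(2)[symmetric] \<delta>(2)[symmetric] \<delta>(3)[symmetric] HOL.refl bc(2)]
    obtain col where col: "\<forall>v. col v < 3" "\<forall>f\<in>D. inj_on col (V f)" "col = col'(b := \<gamma>, c := \<delta>)"
      by blast
    have "col x = \<alpha>" "col y = \<beta>" using x y col'(3,4) by (simp_all add: col(3))
    with col(1,2) show ?thesis by blast
  qed
qed

section \<open>Theories without a finite basis\<close>

text \<open>In the algebra of a hypergraph \<open>HV x\<close> is a vertex, \<open>HTop\<close> is the product of the vertices of any hyperedge, and \<open>HW x\<close> is the product of the two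
  other vertices of any hyperedge containing \<open>x\<close>. A 3-colouring maps it to \<open>S\<^sub>c(x\<^sub>0x\<^sub>1x\<^sub>2)\<close>.\<close>
datatype hel = HInf | HTop | HV nat | HW nat

definition hadd :: "hel \<Rightarrow> hel \<Rightarrow> hel" where
  "hadd x y = (if x = y then x else HInf)"

lemma hadd_idem [simp]: "hadd x x = x"
  by (simp add: hadd_def)

lemma hadd_noninf: "hadd x y \<noteq> HInf \<Longrightarrow> x = y"
  by (simp add: hadd_def split: if_splits)

definition colour_set :: "(nat \<Rightarrow> nat) \<Rightarrow> hel \<Rightarrow> nat set" where
  "colour_set col v =
    (case v of HInf \<Rightarrow> {} | HTop \<Rightarrow> {..<3} | HV x \<Rightarrow> {col x} | HW x \<Rightarrow> {..<3} - {col x})"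

lemma colour_set_simps [simp]:
  "colour_set col HInf = {}" "colour_set col HTop = {..<3}"
  "colour_set col (HV x) = {col x}" "colour_set col (HW x) = {..<3} - {col x}"
  by (simp_all add: colour_set_def)

lemma colour_set_nonempty: "v \<noteq> HInf \<Longrightarrow> colour_set col v \<noteq> {}"
proof (cases v)
  case (HW x)
  obtain \<gamma> where "\<gamma> < 3" "\<gamma> \<noteq> col x" using third_colour by blast
  then show ?thesis using HW by auto
qed (auto simp: lessThan_empty_iff)

text \<open>The girth makes any \<open>n\<close> hyperedges acyclic; \<open>2 \<le> n\<close> is
  what lets two hyperedges share at most one vertex.\<close>

locale sparse_hypergraph =
  fixes \<Omega> :: "nat set" and p :: "nat \<Rightarrow> nat \<Rightarrow> nat" and n :: nat
  assumes sys: "involution_system \<Omega> p (2 * n)" and n: "2 \<le> n"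
begin

definition V :: "nat \<Rightarrow> nat set" where "V e = (\<lambda>c. p c e) ` {..<3}"

lemma V_eq: "V e = {p 0 e, p 1 e, p 2 e}"
proof -
  have "{..<3::nat} = {0, 1, 2}" by auto
  then show ?thesis by (simp add: V_def)
qed

lemma inj_p: "e \<in> \<Omega> \<Longrightarrow> inj_on (\<lambda>c. p c e) {..<3}"
proof (rule inj_onI, rule ccontr)
  fix c d assume e: "e \<in> \<Omega>" and cd: "c \<in> {..<3}" "d \<in> {..<3}" "p c e = p d e" "c \<noteq> d"
  then have "fold p [c, d] e = e" using involution_system_invol[OF sys] by simp
  then show False using involution_system_girth[OF sys e, of "[c, d]"] cd n by simp
qed

lemma card_V: "e \<in> \<Omega> \<Longrightarrow> card (V e) = 3"
  unfolding V_def using card_image[OF inj_p] by simp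

lemma p_distinct: "e \<in> \<Omega> \<Longrightarrow> p 0 e \<noteq> p 1 e \<and> p 0 e \<noteq> p 2 e \<and> p 1 e \<noteq> p 2 e"
  using inj_onD[OF inj_p, of e 0 1] inj_onD[OF inj_p, of e 0 2] inj_onD[OF inj_p, of e 1 2] by auto

lemma leaf: "D \<subseteq> \<Omega> \<Longrightarrow> D \<noteq> {} \<Longrightarrow> card D \<le> n \<Longrightarrow> \<exists>e\<in>D. \<exists>a. \<forall>f\<in>D - {e}. V e \<inter> V f \<subseteq> {a}"
  unfolding V_def by (rule involution_system_leaf[OF sys])

text \<open>The leaf property applied to the pair of hyperedges leaves room for one common vertex
  only.\<close>

lemma edge_unique:
  assumes "e \<in> \<Omega>" "f \<in> \<Omega>" "x \<noteq> y" "{x, y} \<subseteq> V e" "{x, y} \<subseteq> V f"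
  shows "e = f"
proof (rule ccontr)
  assume ef: "e \<noteq> f"
  have "card {e, f} \<le> n" using n ef by simp
  then obtain g a where "g \<in> {e, f}" "\<forall>h\<in>{e, f} - {g}. V g \<inter> V h \<subseteq> {a}"
    using leaf[of "{e, f}"] assms(1,2) by blast
  then have "V e \<inter> V f \<subseteq> {a}" using ef by auto
  then show False using assms(3-5) by auto
qed

definition third :: "nat \<Rightarrow> nat \<Rightarrow> nat" where
  "third x y = (THE z. \<exists>e\<in>\<Omega>. V e = {x, y, z} \<and> x \<noteq> z \<and> y \<noteq> z)"

definition adjacent :: "nat \<Rightarrow> nat \<Rightarrow> bool" where
  "adjacent x y \<longleftrightarrow> x \<noteq> y \<and> (\<exists>e\<in>\<Omega>. {x, y} \<subseteq> V e)"

lemma third_eq: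
  assumes "e \<in> \<Omega>" "V e = {x, y, z}" "x \<noteq> y" "x \<noteq> z" "y \<noteq> z"
  shows "third x y = z"
  unfolding third_def
proof (rule the_equality)
  show "\<exists>e\<in>\<Omega>. V e = {x, y, z} \<and> x \<noteq> z \<and> y \<noteq> z" using assms by blast
  fix z' assume "\<exists>e\<in>\<Omega>. V e = {x, y, z'} \<and> x \<noteq> z' \<and> y \<noteq> z'"
  then obtain f where f: "f \<in> \<Omega>" "V f = {x, y, z'}" "x \<noteq> z'" "y \<noteq> z'" by blast
  have "e = f" using edge_unique[OF assms(1) f(1) assms(3)] assms(2) f(2) by simp
  moreover have "z' \<in> V f" using f(2) by simp
  ultimately have "z' \<in> {x, y, z}" using assms(2) by simp
  then show "z' = z" using f(3,4) by simp
qed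

fun hmul :: "hel \<Rightarrow> hel \<Rightarrow> hel" where
  "hmul (HV x) (HV y) = (if adjacent x y then HW (third x y) else HInf)"
| "hmul (HV x) (HW y) = (if x = y then HTop else HInf)"
| "hmul (HW x) (HV y) = (if x = y then HTop else HInf)"
| "hmul _ _ = HInf"

lemma adjacent_edge:
  assumes "x \<noteq> y" "e \<in> \<Omega>" "{x, y} \<subseteq> V e"
  obtains z where "V e = {x, y, z}" "x \<noteq> z" "y \<noteq> z" "third x y = z"
proof -
  have "card (V e - {x, y}) = 1" using card_V[OF assms(2)] assms by (simp add: card_Diff_subset)
  then obtain z where z: "V e - {x, y} = {z}" by (auto simp: card_1_singleton_iff)
  then have "V e = {x, y, z}" "x \<noteq> z" "y \<noteq> z" using assms(3) by auto
  then show thesis using that third_eq assms by blast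
qed

abbreviation "evh \<equiv> ev hadd hmul"

text \<open>No product is a vertex, so vertices enter an evaluation only through variables. This
  limits the hyperedges that an identity can probe.\<close>

lemma evh_HV: "evh \<tau> s = HV x \<Longrightarrow> \<exists>i\<in>vars s. \<tau> i = HV x"
proof (induction s)
  case (Pl s t)
  then have "hadd (evh \<tau> s) (evh \<tau> t) \<noteq> HInf" by simp
  from hadd_noninf[OF this] Pl show ?case by auto
next
  case (Tm s t)
  then show ?case by (cases "evh \<tau> s"; cases "evh \<tau> t") (simp_all split: if_splits)
qed simp

section \<open>Evaluating terms with few variables in the hypergraph algebra\<close>

context
  fixes \<tau> :: "nat \<Rightarrow> hel" and U :: "nat set"
  assumes finU: "finite U" and cardU: "card U * card U \<le> n"
begin

text \<open>Only these hyperedges can produce a nonzero product of two vertices when a term over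
  \<open>U\<close> is evaluated, so colourings need to respect no others.\<close>

definition D :: "nat set" where
  "D = {e \<in> \<Omega>. \<exists>i\<in>U. \<exists>j\<in>U. \<exists>x y. \<tau> i = HV x \<and> \<tau> j = HV y \<and> x \<noteq> y \<and> {x, y} \<subseteq> V e}"

definition good :: "(nat \<Rightarrow> nat) \<Rightarrow> bool" where
  "good col \<longleftrightarrow> (\<forall>v. col v < 3) \<and> (\<forall>e\<in>D. inj_on col (V e))"

lemma D_subset: "D \<subseteq> \<Omega>"
  by (auto simp: D_def)

lemma finite_D: "finite D"
  using D_subset involution_system_finite[OF sys] finite_subset by blast

text \<open>By \<open>edge_unique\<close>, a pair of variables determines at most one
  hyperedge.\<close>

lemma card_D: "card D \<le> n"
proof -
  define g where "g ij = (SOME e. e \<in> \<Omega> \<and> (\<exists>x y. \<tau> (fst ij) = HV x \<and> \<tau> (snd ij) = HV y \<and>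
      x \<noteq> y \<and> {x, y} \<subseteq> V e))" for ij
  have "D \<subseteq> g ` (U \<times> U)"
  proof
    fix e assume "e \<in> D"
    then obtain i j x y where e: "e \<in> \<Omega>" and ij: "i \<in> U" "j \<in> U"
      and xy: "\<tau> i = HV x" "\<tau> j = HV y" "x \<noteq> y" "{x, y} \<subseteq> V e"
      by (auto simp: D_def)
    have "\<exists>e. e \<in> \<Omega> \<and> (\<exists>x y. \<tau> (fst (i, j)) = HV x \<and> \<tau> (snd (i, j)) = HV y \<and> x \<noteq> y \<and> {x, y} \<subseteq> V e)"
      using e xy by auto
    from someI_ex[OF this] have "g (i, j) \<in> \<Omega>" "{x, y} \<subseteq> V (g (i, j))"
      unfolding g_def using xy by auto
    then have "g (i, j) = e" using edge_unique e xy by blast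
    then show "e \<in> g ` (U \<times> U)" using ij by blast
  qed
  then have "card D \<le> card (U \<times> U)"
    using surj_card_le finU by (metis finite_cartesian_product)
  then show ?thesis using cardU by (simp add: card_cartesian_product)
qed

lemma good_exists:
  assumes "x \<noteq> y" "\<alpha> < 3" "\<beta> < 3" "\<alpha> \<noteq> \<beta> \<or> (\<forall>e\<in>D. \<not> {x, y} \<subseteq> V e)"
  shows "\<exists>col. good col \<and> col x = \<alpha> \<and> col y = \<beta>"
proof -
  have "\<exists>e\<in>D'. \<exists>a. \<forall>f\<in>D' - {e}. V e \<inter> V f \<subseteq> {a}" if "D' \<subseteq> D" "D' \<noteq> {}" for D'
    using leaf[of D'] that D_subset card_mono[OF finite_D that(1)] card_D by auto
  moreover have "card (V e) = 3" if "e \<in> D" for e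
    using card_V D_subset that by blast
  ultimately show ?thesis
    unfolding good_def using rainbow_colouring[OF finite_D _ _ assms] by simp
qed

lemma good_lt: "good col \<Longrightarrow> col v < 3"
  by (simp add: good_def)

text \<open>Cardinality separates vertices, products of two and \<open>HTop\<close>; within a kind,
  some good colouring distinguishes any two vertices.\<close>

lemma colour_set_inject:
  assumes "u \<noteq> HInf" "v \<noteq> HInf" and eq: "\<And>col. good col \<Longrightarrow> colour_set col u = colour_set col v"
  shows "u = v"
proof -
  obtain col0 where col0: "good col0" using good_exists[of 0 1 0 1] by auto
  have card_HW: "card ({..<3::nat} - {col0 x}) = 2" for x
    using good_lt[OF col0, of x] by (simp add: card_Diff_subset)
  have ne: "\<exists>col. good col \<and> col x \<noteq> col y" if "x \<noteq> y" for x y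
    using good_exists[OF that, of 0 1] by auto
  have cards: "card (colour_set col0 u) = card (colour_set col0 v)" using eq[OF col0] by simp
  show ?thesis
  proof (cases u)
    case (HV x)
    with cards assms obtain y where y: "v = HV y" by (cases v) (simp_all add: card_HW)
    then have "\<forall>col. good col \<longrightarrow> col x = col y" using eq HV by simp
    then show ?thesis using ne HV y by blast
  next
    case (HW x)
    with cards assms obtain y where y: "v = HW y" by (cases v) (simp_all add: card_HW)
    have "col x = col y" if "good col" for col
    proof -
      have "{..<3} - {col x} = {..<3} - {col y}" using eq[OF that] HW y by simp
      then show ?thesis using good_lt[OF that, of x] good_lt[OF that, of y] by blast
    qed
    then show ?thesis using ne HW y by blast
  next
    case HTop
    with cards assms show ?thesis by (cases v) (simp_all add: card_HW)
  qed (use assms in simp)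
qed

text \<open>Two vertices in no common hyperedge of \<open>D\<close> can be coloured alike, so
  colours that always differ force adjacency.\<close>

lemma hmul_noninf:
  assumes "u \<noteq> HInf" "v \<noteq> HInf"
    and disj: "\<And>col. good col \<Longrightarrow> colour_set col u \<inter> colour_set col v = {}"
  shows "hmul u v \<noteq> HInf"
proof -
  obtain col0 where col0: "good col0" using good_exists[of 0 1 0 1] by auto
  have VW: "x = y" if *: "\<And>col. good col \<Longrightarrow> {col x} \<inter> ({..<3} - {col y}) = {}" for x y
  proof (rule ccontr)
    assume "x \<noteq> y"
    from good_exists[OF this, of 0 1] obtain col where "good col" "col x = 0" "col y = 1" by auto
    then show False using *[of col] by simp
  qed
  have top: "False" if "colour_set col0 w \<inter> {..<3} = {}" "w \<noteq> HInf" for w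
  proof -
    have "colour_set col0 w \<subseteq> {..<3}" using good_lt[OF col0] by (cases w) auto
    then show False using that colour_set_nonempty[of w col0] by blast
  qed
  show ?thesis
  proof (cases u)
    case HTop
    then show ?thesis using top[of v] disj[OF col0] assms by auto
  next
    case uV: (HV x)
    show ?thesis
    proof (cases v)
      case HTop
      then show ?thesis using top[of u] disj[OF col0] assms by auto
    next
      case (HV y)
      have xy: "x \<noteq> y" using disj[OF col0] uV HV by auto
      have "\<exists>e\<in>D. {x, y} \<subseteq> V e"
      proof (rule ccontr)
        assume "\<not> ?thesis"
        then obtain col where "good col" "col x = 0" "col y = 0"
          using good_exists[OF xy, of 0 0] by auto
        then show False using disj[of col] uV HV by simp
      qed
      then have "adjacent x y" using xy D_subset by (auto simp: adjacent_def)
      then show ?thesis using uV HV by simp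
    next
      case (HW y)
      then show ?thesis using VW[of x y] disj uV by simp
    qed (use assms in simp)
  next
    case uW: (HW x)
    show ?thesis
    proof (cases v)
      case HTop
      then show ?thesis using top[of u] disj[OF col0] assms by auto
    next
      case (HV y)
      then show ?thesis using VW[of y x] disj uW by (simp add: Int_commute)
    next
      case (HW y)
      obtain \<gamma> where "\<gamma> < 3" "\<gamma> \<noteq> col0 x" "\<gamma> \<noteq> col0 y" using third_colour by blast
      then show ?thesis using disj[OF col0] uW HW by auto
    qed (use assms in simp)
  qed (use assms in simp)
qed

text \<open>The hyperedge of two adjacent vertices belongs to \<open>D\<close>, as both are values
  of variables in \<open>U\<close>. A good colouring is injective on it and gives the third vertex
  the remaining colour.\<close>

lemma colour_set_hmul:
  assumes "hmul u v \<noteq> HInf" and col: "good col"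
    and D: "\<And>x y. u = HV x \<Longrightarrow> v = HV y \<Longrightarrow> x \<noteq> y \<Longrightarrow> \<exists>i\<in>U. \<exists>j\<in>U. \<tau> i = HV x \<and> \<tau> j = HV y"
  shows "dmul (colour_set col u) (colour_set col v) = colour_set col (hmul u v)"
proof -
  have union: "insert c ({..<3} - {c}) = {..<3}" if "c < 3" for c :: nat using that by auto
  have VW: "dmul {col x} ({..<3} - {col x}) = {..<3}" "dmul ({..<3} - {col x}) {col x} = {..<3}" for x
  proof -
    have "{..<3} - {col x} \<noteq> {}" using colour_set_nonempty[of "HW x" col] by simp
    then show "dmul {col x} ({..<3} - {col x}) = {..<3}" "dmul ({..<3} - {col x}) {col x} = {..<3}"
      using union[OF good_lt[OF col, of x]] by (simp_all add: dmul_disjoint)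
  qed
  show ?thesis
  proof (cases u)
    case uV: (HV x)
    show ?thesis
    proof (cases v)
      case (HV y)
      then have "adjacent x y" using assms(1) uV by (simp split: if_splits)
      then obtain e where xy: "x \<noteq> y" and e: "e \<in> \<Omega>" "{x, y} \<subseteq> V e" by (auto simp: adjacent_def)
      then obtain z where z: "V e = {x, y, z}" "x \<noteq> z" "y \<noteq> z" "third x y = z"
        by (rule adjacent_edge)
      have "e \<in> D" using D[OF uV HV xy] xy e by (auto simp: D_def)
      then have "inj_on col (V e)" using col by (simp add: good_def)
      then have "inj_on col {x, y, z}" by (simp only: z(1))
      then have ne: "col x \<noteq> col y" "col x \<noteq> col z" "col y \<noteq> col z"
        using xy z(2,3) unfolding inj_on_def by blast+
      have "{col x, col y} = {..<3} - {col z}"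
      proof (rule card_subset_eq)
        show "card {col x, col y} = card ({..<3} - {col z})"
          using ne good_lt[OF col, of z] by (simp add: card_Diff_subset)
      qed (use ne good_lt[OF col] in auto)
      then show ?thesis using uV HV \<open>adjacent x y\<close> z(4) ne(1) by (simp add: dmul_disjoint insert_commute)
    next
      case (HW y)
      then show ?thesis using uV assms(1) VW by (simp split: if_splits)
    qed (use assms(1) uV in simp_all)
  next
    case uW: (HW x)
    show ?thesis
    proof (cases v)
      case (HV y)
      then show ?thesis using uW assms(1) VW by (simp split: if_splits)
    qed (use assms(1) uW in simp_all)
  qed (use assms(1) in \<open>cases v; simp\<close>)+
qed

lemma evd_colour_set:
  "good col \<Longrightarrow> vars s \<subseteq> U \<Longrightarrow> evh \<tau> s \<noteq> HInf \<Longrightarrow>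
    evd (\<lambda>i. colour_set col (\<tau> i)) s = colour_set col (evh \<tau> s)"
proof (induction s)
  case (Pl s t)
  have "evh \<tau> s = evh \<tau> t" using hadd_noninf Pl.prems(3) by simp
  then show ?case using Pl by simp
next
  case (Tm s t)
  have ne: "hmul (evh \<tau> s) (evh \<tau> t) \<noteq> HInf" using Tm.prems(3) by simp
  then have "evh \<tau> s \<noteq> HInf" "evh \<tau> t \<noteq> HInf"
    by (cases "evh \<tau> s"; cases "evh \<tau> t"; simp)+
  then have "evd (\<lambda>i. colour_set col (\<tau> i)) s = colour_set col (evh \<tau> s)"
    "evd (\<lambda>i. colour_set col (\<tau> i)) t = colour_set col (evh \<tau> t)"
    using Tm by simp_all
  moreover have "dmul (colour_set col (evh \<tau> s)) (colour_set col (evh \<tau> t)) =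
      colour_set col (hmul (evh \<tau> s) (evh \<tau> t))"
  proof (rule colour_set_hmul[OF ne Tm.prems(1)])
    fix x y assume "evh \<tau> s = HV x" "evh \<tau> t = HV y"
    from evh_HV[OF this(1)] evh_HV[OF this(2)] Tm.prems(2)
    show "\<exists>i\<in>U. \<exists>j\<in>U. \<tau> i = HV x \<and> \<tau> j = HV y" by auto
  qed
  ultimately show ?case by simp
qed simp

text \<open>Good colourings act as coordinates: a zero in the hypergraph algebra is witnessed by one
  of them, as in \<open>evd_nonempty\<close>.\<close>

lemma evh_noninf:
  "vars t \<subseteq> U \<Longrightarrow> (\<And>col. good col \<Longrightarrow> evd (\<lambda>i. colour_set col (\<tau> i)) t \<noteq> {}) \<Longrightarrow> evh \<tau> t \<noteq> HInf"
proof (induction t)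
  case (Var x)
  obtain col0 where "good col0" using good_exists[of 0 1 0 1] by auto
  from Var.prems(2)[OF this] show ?case by auto
next
  case (Pl s t)
  let ?e = "\<lambda>col. evd (\<lambda>i. colour_set col (\<tau> i))"
  have eq: "?e col s = ?e col t" if "good col" for col
    using dadd_nonempty Pl.prems(2)[OF that] by simp
  have ne: "?e col s \<noteq> {}" "?e col t \<noteq> {}" if "good col" for col
    using Pl.prems(2)[OF that] eq[OF that] by simp_all
  have s: "vars s \<subseteq> U" and t: "vars t \<subseteq> U" using Pl.prems(1) by auto
  have i: "evh \<tau> s \<noteq> HInf" "evh \<tau> t \<noteq> HInf"
    using Pl.IH(1)[OF s] Pl.IH(2)[OF t] ne by blast+
  have "evh \<tau> s = evh \<tau> t"
  proof (rule colour_set_inject[OF i])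
    fix col assume col: "good col"
    from eq[OF col] evd_colour_set[OF col s i(1)] evd_colour_set[OF col t i(2)]
    show "colour_set col (evh \<tau> s) = colour_set col (evh \<tau> t)" by argo
  qed
  then show ?case using i by simp
next
  case (Tm s t)
  let ?e = "\<lambda>col. evd (\<lambda>i. colour_set col (\<tau> i))"
  have ne: "?e col s \<noteq> {}" "?e col t \<noteq> {}" "?e col s \<inter> ?e col t = {}" if "good col" for col
    using dmul_nonempty[of "?e col s" "?e col t"] Tm.prems(2)[OF that] by simp_all
  have s: "vars s \<subseteq> U" and t: "vars t \<subseteq> U" using Tm.prems(1) by auto
  have i: "evh \<tau> s \<noteq> HInf" "evh \<tau> t \<noteq> HInf"
    using Tm.IH(1)[OF s] Tm.IH(2)[OF t] ne by blast+
  have "hmul (evh \<tau> s) (evh \<tau> t) \<noteq> HInf"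
  proof (rule hmul_noninf[OF i])
    fix col assume col: "good col"
    from ne(3)[OF col] evd_colour_set[OF col s i(1)] evd_colour_set[OF col t i(2)]
    show "colour_set col (evh \<tau> s) \<inter> colour_set col (evh \<tau> t) = {}" by argo
  qed
  then show ?case by simp
qed

lemma evh_eq_if_noninf:
  assumes st: "(s, t) \<in> IdS 3" and U: "vars s \<subseteq> U" "vars t \<subseteq> U" and s: "evh \<tau> s \<noteq> HInf"
  shows "evh \<tau> s = evh \<tau> t"
proof -
  let ?e = "\<lambda>col. evd (\<lambda>i. colour_set col (\<tau> i))"
  have eq: "?e col s = ?e col t" if "good col" for col
  proof (rule IdsD[OF st[unfolded IdS_def]])
    fix i show "colour_set col (\<tau> i) \<in> Pow {..<3}"
      using good_lt[OF that] by (cases "\<tau> i") auto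
  qed
  have t: "evh \<tau> t \<noteq> HInf"
  proof (rule evh_noninf[OF U(2)])
    fix col assume col: "good col"
    show "?e col t \<noteq> {}"
      using eq[OF col] evd_colour_set[OF col U(1) s] colour_set_nonempty[OF s, of col] by simp
  qed
  show ?thesis
  proof (rule colour_set_inject[OF s t])
    fix col assume col: "good col"
    from eq[OF col] evd_colour_set[OF col U(1) s] evd_colour_set[OF col U(2) t]
    show "colour_set col (evh \<tau> s) = colour_set col (evh \<tau> t)" by argo
  qed
qed

end

lemma evh_identity:
  assumes st: "(s, t) \<in> IdS 3" and c: "card (vars s \<union> vars t) * card (vars s \<union> vars t) \<le> n"
  shows "evh \<tau> s = evh \<tau> t"
proof (cases "evh \<tau> s = HInf \<and> evh \<tau> t = HInf")
  case False
  have fin: "finite (vars s \<union> vars t)" by simp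
  note half = evh_eq_if_noninf[OF fin c]
  from False show ?thesis
    using half[OF st] half[OF eq_theory_sym[OF eq_theory_IdS st]] by fastforce
qed simp

section \<open>An identity of S7 that fails in the hypergraph algebra\<close>

definition tri :: "nat \<Rightarrow> trm" where
  "tri e = Tm (Var (p 0 e)) (Tm (Var (p 1 e)) (Var (p 2 e)))"

lemma evh_tri: "e \<in> \<Omega> \<Longrightarrow> evh HV (tri e) = HTop"
proof -
  assume e: "e \<in> \<Omega>"
  note d = p_distinct[OF e]
  have "adjacent (p 1 e) (p 2 e)" using d e by (auto simp: adjacent_def V_eq)
  moreover have "third (p 1 e) (p 2 e) = p 0 e"
    by (rule third_eq[OF e]) (use d in \<open>auto simp: V_eq\<close>)
  ultimately show ?thesis by (simp add: tri_def)
qed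

lemma evh_foldr: "(\<And>u. u \<in> set us \<Longrightarrow> evh \<tau> u = evh \<tau> w) \<Longrightarrow> evh \<tau> (foldr Pl us w) = evh \<tau> w"
  by (induction us) auto

text \<open>If a sum of all hyperedges takes the value \<open>a\<close> in S7, then every hyperedge has exactly
  one vertex with value \<open>a\<close>. As every vertex is in three hyperedges, these vertices are one
  third of all vertices, but 3 does not divide a power of 2.\<close>
lemma no_transversal: "\<not> (\<forall>e\<in>\<Omega>. \<exists>!c. c < 3 \<and> p c e \<in> X)"
proof
  assume ex: "\<forall>e\<in>\<Omega>. \<exists>!c. c < 3 \<and> p c e \<in> X"
  have fin: "finite \<Omega>" by (rule involution_system_finite[OF sys])
  have "card {c \<in> {..<3}. p c e \<in> X} = 1" if "e \<in> \<Omega>" for e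
  proof -
    from ex that obtain c where "c < 3" "p c e \<in> X" "\<And>d. d < 3 \<Longrightarrow> p d e \<in> X \<Longrightarrow> d = c"
      by blast
    then have "{c \<in> {..<3}. p c e \<in> X} = {c}" by blast
    then show ?thesis by simp
  qed
  then have "card \<Omega> = (\<Sum>e\<in>\<Omega>. card {c \<in> {..<3}. p c e \<in> X})" by simp
  also have "\<dots> = (\<Sum>c\<in>{..<3}. card {e \<in> \<Omega>. p c e \<in> X})"
    using sum_multicount_gen[of \<Omega> "{..<3}" "\<lambda>e c. p c e \<in> X" "\<lambda>c. card {e \<in> \<Omega>. p c e \<in> X}"] fin by simp
  also have "\<dots> = (\<Sum>c\<in>{..<3::nat}. card (\<Omega> \<inter> X))"
  proof (rule sum.cong[OF HOL.refl])
    fix c :: nat assume "c \<in> {..<3}"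
    then have c: "c < 3" by simp
    have "bij_betw (p c) {e \<in> \<Omega>. p c e \<in> X} (\<Omega> \<inter> X)"
      by (rule bij_betw_byWitness[where f' = "p c"])
        (use involution_system_in[OF sys c] involution_system_invol[OF sys c] in auto)
    then show "card {e \<in> \<Omega>. p c e \<in> X} = card (\<Omega> \<inter> X)" by (rule bij_betw_same_card)
  qed
  also have "\<dots> = 3 * card (\<Omega> \<inter> X)" by simp
  finally have "3 dvd card \<Omega>" by simp
  moreover obtain m where "card \<Omega> = 2 ^ m" using involution_system_card[OF sys] by blast
  moreover have "\<not> 3 dvd (2::nat) ^ m"
  proof (induction m)
    case (Suc m)
    have "\<not> 3 dvd 2 * x" if "\<not> 3 dvd x" for x :: nat using that by presburger
    from this[OF Suc] show ?case by simp
  qed simp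
  ultimately show False by simp
qed

text \<open>In S7 only \<open>A\<close> differs from its square, and the value \<open>A\<close>
  would yield a transversal. In the hypergraph algebra all summands equal \<open>HTop\<close>, whose
  square is \<open>HInf\<close>.\<close>

lemma separating_identity: "\<exists>t. (t, Tm t t) \<in> Id_S7 \<and> evh HV t \<noteq> evh HV (Tm t t)"
proof -
  have fin: "finite \<Omega>" by (rule involution_system_finite[OF sys])
  then obtain es where es: "set es = \<Omega>" using finite_list by blast
  have "card \<Omega> \<noteq> 0" using involution_system_card[OF sys] by auto
  then obtain e0 where e0: "e0 \<in> \<Omega>" by fastforce
  define t where "t = foldr Pl (map tri es) (tri e0)"
  have "evh HV t = HTop"
    unfolding t_def using evh_foldr[of "map tri es" HV "tri e0"] evh_tri e0 es by auto
  moreover have "(t, Tm t t) \<in> Id_S7"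
  proof (rule Id_S7I)
    fix \<sigma> :: "nat \<Rightarrow> el" assume \<sigma>: "\<forall>i. \<sigma> i \<in> car7"
    have "ev7 \<sigma> t \<noteq> A"
    proof
      assume A: "ev7 \<sigma> t = A"
      have tri: "ev7 \<sigma> (tri e) = A" if "e \<in> \<Omega>" for e
        using A that es unfolding t_def ev7_foldr_Pl by (auto split: if_splits)
      have "\<exists>!c. c < 3 \<and> p c e \<in> {v. \<sigma> v = A}" if e: "e \<in> \<Omega>" for e
      proof -
        have "ev7 \<sigma> (tri e) = S7_mult.F (\<lambda>c. \<sigma> (p c e)) {0, 1, 2}" by (simp add: tri_def)
        then obtain c where c: "c \<in> {0, 1, 2}" "\<sigma> (p c e) = A"
          "\<forall>d\<in>{0, 1, 2} - {c}. \<sigma> (p d e) = One"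
          using S7_prod_A[of "{0, 1, 2}" "\<lambda>c. \<sigma> (p c e)"] tri[OF e] by auto
        have three: "d < 3 \<longleftrightarrow> d \<in> {0, 1, 2}" for d :: nat by auto
        show ?thesis
        proof (rule ex1I[of _ c])
          show "c < 3 \<and> p c e \<in> {v. \<sigma> v = A}" using c three by blast
          fix d assume d: "d < 3 \<and> p d e \<in> {v. \<sigma> v = A}"
          show "d = c"
          proof (rule ccontr)
            assume "d \<noteq> c"
            then have "\<sigma> (p d e) = One" using c(3) d three by blast
            then show False using d by simp
          qed
        qed
      qed
      then have "\<forall>e\<in>\<Omega>. \<exists>!c. c < 3 \<and> p c e \<in> {v. \<sigma> v = A}" by (rule ballI)
      from no_transversal[of "{v. \<sigma> v = A}"] this show False by (rule notE)
    qed
    moreover have "ev7 \<sigma> t \<in> car7" using ev7_in[of \<sigma> t] \<sigma> by blast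
    ultimately show "ev7 \<sigma> t = ev7 \<sigma> (Tm t t)" by (auto simp: mulS_def)
  qed
  ultimately show ?thesis by auto
qed

end

lemma not_finitely_based:
  assumes "Id_S7 \<subseteq> T" and "T \<subseteq> IdS 3"
  shows "\<not> finitely_based T"
proof
  assume "finitely_based T"
  then obtain \<Sigma> where fin: "finite \<Sigma>" and \<Sigma>: "Cn \<Sigma> = T" by (auto simp: finitely_based_def)
  define N where "N = (\<Sum>(s, t)\<in>\<Sigma>. card (vars s \<union> vars t))"
  have N: "card (vars s \<union> vars t) \<le> N" if "(s, t) \<in> \<Sigma>" for s t
    using member_le_sum[OF that, of "\<lambda>(s, t). card (vars s \<union> vars t)"] fin by (simp add: N_def)
  \<comment> \<open>\<open>N * N\<close> bounds the number of pairs of variables in any identity of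
    \<open>\<Sigma>\<close>; adding 2 ensures \<open>2 \<le> n\<close>.\<close>
  obtain \<Omega> :: "nat set" and p where "involution_system \<Omega> p (2 * (N * N + 2))"
    using involution_system_exists by blast
  then interpret sparse_hypergraph \<Omega> p "N * N + 2" by unfold_locales simp_all
  have "\<Sigma> \<subseteq> Ids UNIV hadd hmul"
  proof (rule subrelI)
    fix s t assume st: "(s, t) \<in> \<Sigma>"
    then have "(s, t) \<in> IdS 3" using \<Sigma> assms(2) Cn.base by blast
    moreover have "card (vars s \<union> vars t) * card (vars s \<union> vars t) \<le> N * N + 2"
      using mult_le_mono[OF N[OF st] N[OF st]] by simp
    ultimately show "(s, t) \<in> Ids UNIV hadd hmul"
      by (intro IdsI evh_identity)
  qed
  then have T: "T \<subseteq> Ids UNIV hadd hmul"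
    using Cn_subset_Ids[of UNIV hadd hmul \<Sigma>] \<Sigma> by simp
  obtain t where t: "(t, Tm t t) \<in> Id_S7" "evh HV t \<noteq> evh HV (Tm t t)"
    using separating_identity by blast
  then have "(t, Tm t t) \<in> Ids UNIV hadd hmul" using assms(1) T by blast
  from IdsD[OF this, of HV] t(2) show False by simp
qed

section \<open>The classification\<close>

lemma Ids_bij_hom:
  fixes C :: "'a set" and C' :: "'b set"
  assumes bij: "bij_betw h C C'"
    and p: "\<And>x y. x \<in> C \<Longrightarrow> y \<in> C \<Longrightarrow> p x y \<in> C \<and> h (p x y) = p' (h x) (h y)"
    and m: "\<And>x y. x \<in> C \<Longrightarrow> y \<in> C \<Longrightarrow> m x y \<in> C \<and> h (m x y) = m' (h x) (h y)"
  shows "Ids C p m = Ids C' p' m'"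
proof -
  have hom: "ev p m \<sigma> t \<in> C \<and> h (ev p m \<sigma> t) = ev p' m' (\<lambda>i. h (\<sigma> i)) t"
    if "\<And>i. \<sigma> i \<in> C" for \<sigma> t
    by (induction t) (use that p m in auto)
  have C': "h x \<in> C'" if "x \<in> C" for x using bij_betwE[OF bij] that by blast
  have inv: "inv_into C h y \<in> C \<and> h (inv_into C h y) = y" if "y \<in> C'" for y
    using that bij by (simp add: bij_betw_def inv_into_into f_inv_into_f)
  show ?thesis
  proof (intro equalityI subrelI)
    fix s t assume st: "(s, t) \<in> Ids C p m"
    show "(s, t) \<in> Ids C' p' m'"
    proof (rule IdsI)
      fix \<tau> :: "nat \<Rightarrow> 'b" assume "\<forall>i. \<tau> i \<in> C'"
      then have \<tau>: "\<And>i. inv_into C h (\<tau> i) \<in> C" "\<And>i. h (inv_into C h (\<tau> i)) = \<tau> i"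
        using inv by blast+
      have "ev p m (\<lambda>i. inv_into C h (\<tau> i)) s = ev p m (\<lambda>i. inv_into C h (\<tau> i)) t"
        by (rule IdsD[OF st \<tau>(1)])
      then show "ev p' m' \<tau> s = ev p' m' \<tau> t"
        using hom[of "\<lambda>i. inv_into C h (\<tau> i)" s, OF \<tau>(1)] hom[of "\<lambda>i. inv_into C h (\<tau> i)" t, OF \<tau>(1)]
        by (simp add: \<tau>(2))
    qed
  next
    fix s t assume st: "(s, t) \<in> Ids C' p' m'"
    show "(s, t) \<in> Ids C p m"
    proof (rule IdsI)
      fix \<sigma> :: "nat \<Rightarrow> 'a" assume "\<forall>i. \<sigma> i \<in> C"
      then have \<sigma>: "\<And>i. \<sigma> i \<in> C" by blast
      have "ev p' m' (\<lambda>i. h (\<sigma> i)) s = ev p' m' (\<lambda>i. h (\<sigma> i)) t"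
        by (rule IdsD[OF st C'[OF \<sigma>]])
      then show "ev p m \<sigma> s = ev p m \<sigma> t"
        using hom[of \<sigma> s, OF \<sigma>] hom[of \<sigma> t, OF \<sigma>] bij
          inj_onD[of h C "ev p m \<sigma> s" "ev p m \<sigma> t"] by (simp add: bij_betw_def)
    qed
  qed
qed

definition subword :: "el \<Rightarrow> nat set" where
  "subword v = (case v of A \<Rightarrow> {0} | B \<Rightarrow> {1} | AB \<Rightarrow> {0, 1} | _ \<Rightarrow> {})"

lemma Id_Sca_eq: "Id_Sca = IdS 1"
  unfolding Id_Sca_def Id_alg_eq_Ids IdS_def
proof (rule Ids_bij_hom)
  have "Pow {..<1::nat} = {{0}, {}}" by (auto simp: lessThan_Suc)
  then show "bij_betw subword {A, Inf} (Pow {..<1})"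
    by (auto simp: bij_betw_def subword_def)
qed (auto simp: subword_def fadd_def mulSa_def dadd_def dmul_def)

lemma Id_Scab_eq: "Id_Scab = IdS 2"
  unfolding Id_Scab_def Id_alg_eq_Ids IdS_def
proof (rule Ids_bij_hom)
  have "{..<2::nat} = {0, 1}" by auto
  then have "Pow {..<2::nat} = {{0}, {1}, {0, 1}, {}}" by (auto simp: Pow_insert)
  then show "bij_betw subword {A, B, AB, Inf} (Pow {..<2})"
    by (auto simp: bij_betw_def subword_def)
qed (auto simp: subword_def fadd_def dadd_def dmul_def)

section \<open>Identities that axiomatise and separate the six theories\<close>

abbreviation nil :: "nat \<Rightarrow> identity" where
  "nil k \<equiv> (linear_word k, Tm (linear_word k) (linear_word k))"

abbreviation squares :: identity where
  "squares \<equiv> (Tm (Var 0) (Var 0), Tm (Var 1) (Var 1))"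

lemma dmul_self [simp]: "dmul X X = {}"
  by (simp add: dmul_def)

lemma nil_in_Id_M2: "nil k \<in> Id_M2"
  unfolding Id_M2_eq
proof (rule IdsI)
  fix \<sigma> :: "nat \<Rightarrow> el" assume "\<forall>i. \<sigma> i \<in> {One, Inf}"
  then have "ev7 \<sigma> (linear_word k) \<in> {One, Inf}"
    by (intro ev_closed) (auto simp: fadd_def mulS_def)
  then show "ev7 \<sigma> (linear_word k) = ev7 \<sigma> (Tm (linear_word k) (linear_word k))"
    by (auto simp: mulS_def)
qed

text \<open>The factors of a nonzero product have nonempty disjoint values, so each contributes an
  element.\<close>

lemma card_evd_lprod:
  assumes "\<And>i. finite (\<sigma> i)"
  shows "evd \<sigma> (lprod xs) \<noteq> {} \<Longrightarrow> length xs \<le> card (evd \<sigma> (lprod xs)) \<and> finite (evd \<sigma> (lprod xs))"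
proof (induction xs rule: lprod.induct)
  case (3 x y xs)
  let ?Y = "evd \<sigma> (lprod (y # xs))"
  have ne: "\<sigma> x \<noteq> {}" "?Y \<noteq> {}" "\<sigma> x \<inter> ?Y = {}"
    using 3(2) dmul_nonempty[of "\<sigma> x" ?Y] by auto
  have "length (y # xs) \<le> card ?Y" "finite ?Y" using 3(1)[OF ne(2)] by blast+
  moreover have "1 \<le> card (\<sigma> x)" using ne(1) assms by (simp add: Suc_le_eq card_gt_0_iff)
  ultimately show ?case using ne assms by (simp add: dmul_disjoint card_Un_disjoint)
qed (use assms in \<open>simp_all add: Suc_le_eq card_gt_0_iff\<close>)

lemma nil_in_IdS: "k < l \<Longrightarrow> nil l \<in> IdS k"
  unfolding IdS_def
proof (rule IdsI)
  fix \<sigma> :: "nat \<Rightarrow> nat set" assume kl: "k < l" and \<sigma>: "\<forall>i. \<sigma> i \<in> Pow {..<k}"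
  have "evd \<sigma> (linear_word l) = {}"
  proof (rule ccontr)
    assume ne: "evd \<sigma> (linear_word l) \<noteq> {}"
    have "finite (\<sigma> i)" for i using \<sigma> finite_subset[of "\<sigma> i" "{..<k}"] by blast
    from card_evd_lprod[OF this ne] have "l \<le> card (evd \<sigma> (linear_word l))" by simp
    also have "\<dots> \<le> card {..<k}"
      using evd_in[of \<sigma> k "linear_word l"] \<sigma> by (intro card_mono) auto
    finally show False using kl by simp
  qed
  then show "evd \<sigma> (linear_word l) = evd \<sigma> (Tm (linear_word l) (linear_word l))" by simp
qed

lemma nil_not_in_IdS: "0 < k \<Longrightarrow> nil k \<notin> IdS k"
proof
  assume k: "0 < k" and "nil k \<in> IdS k"
  define \<sigma> where "\<sigma> i = (if i < k then {i} else {})" for i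
  have "evd \<sigma> (linear_word k) = evd \<sigma> (Tm (linear_word k) (linear_word k))"
    by (rule IdsD[OF \<open>nil k \<in> IdS k\<close>[unfolded IdS_def]]) (simp add: \<sigma>_def)
  moreover have "evd \<sigma> (linear_word k) = {..<k}"
    using evd_lprod[of "[0..<k]" \<sigma>] k by (simp add: \<sigma>_def atLeast0LessThan)
  ultimately show False using k by (auto simp: lessThan_empty_iff)
qed

lemma squares_in_IdS: "squares \<in> IdS k"
  unfolding IdS_def by (rule IdsI) simp

lemma squares_not_in_Id_M2: "squares \<notin> Id_M2"
proof
  assume "squares \<in> Id_M2"
  from vars_eq_if_Id_M2[OF this] show False by simp
qed

text \<open>\<open>nil 3\<close> witnesses that this theory is not included in \<open>IdS 3\<close>,
  so \<open>basis_subset\<close> replaces a check of the single identities.\<close>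

lemma basis_subset_Id_M2_Int_IdS_2: "basis \<subseteq> Id_M2 \<inter> IdS 2"
proof (rule basis_subset)
  show "\<not> Id_M2 \<inter> IdS 2 \<subseteq> IdS 3"
    using nil_in_Id_M2[of 3] nil_in_IdS[of 2 3] nil_not_in_IdS[of 3] by auto
qed (use Id_S7_subset_Id_M2 Id_S7_subset_IdS eq_theory_Id_M2 eq_theory_IdS in
    \<open>simp_all add: eq_theory_Int\<close>)

lemma finite_basis: "finite basis"
  by (simp add: basis_def S7_basis_def Let_def)

lemma finitely_based_Id_M2_Int_IdS:
  assumes "k \<le> 2"
  shows "finitely_based (Id_M2 \<inter> IdS k)"
proof -
  let ?S = "insert (nil (Suc k)) basis"
  have "Cn ?S \<subseteq> Id_M2 \<inter> IdS k"
    using basis_subset_Id_M2_Int_IdS_2 IdS_antimono[OF assms] nil_in_Id_M2[of "Suc k"] nil_in_IdS[of k "Suc k"]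
    by (intro Cn_least eq_theory_Int eq_theory_Id_M2 eq_theory_IdS) (auto simp del: upt_Suc)
  moreover have "?S \<subseteq> Cn ?S" by (auto intro: Cn.base)
  then have "Id_M2 \<inter> IdS k \<subseteq> Cn ?S"
    by (intro Id_M2_Int_IdS_subset eq_theory_Cn assms) auto
  ultimately show ?thesis
    unfolding finitely_based_def using finite_basis by (intro exI[of _ ?S]) auto
qed

lemma finitely_based_IdS:
  assumes "k \<le> 2"
  shows "finitely_based (IdS k)"
proof -
  let ?S = "insert squares (insert (nil (Suc k)) basis)"
  have "Cn ?S \<subseteq> IdS k"
    using basis_subset_Id_M2_Int_IdS_2 IdS_antimono[OF assms] squares_in_IdS nil_in_IdS[of k "Suc k"]
    by (intro Cn_least eq_theory_IdS) (auto simp del: upt_Suc)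
  moreover have "?S \<subseteq> Cn ?S" by (auto intro: Cn.base)
  then have "IdS k \<subseteq> Cn ?S"
    by (intro IdS_subset eq_theory_Cn assms) auto
  ultimately show ?thesis
    unfolding finitely_based_def using finite_basis by (intro exI[of _ ?S]) auto
qed

lemma finitely_based_cases:
  assumes T: "eq_theory T" and S7: "Id_S7 \<subseteq> T" and "finitely_based T"
  shows "\<exists>k\<le>2. T = IdS k \<or> T = Id_M2 \<inter> IdS k"
proof -
  have T3: "\<not> T \<subseteq> IdS 3" using not_finitely_based S7 assms(3) by blast
  \<comment> \<open>Minimality gives \<open>T \<subseteq> IdS k\<close>, which for
    \<open>k = 0\<close> holds because \<open>IdS 0\<close> is everything.\<close>
  define k where "k = (LEAST k. \<not> T \<subseteq> IdS (Suc k))"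
  have "\<not> T \<subseteq> IdS (Suc 2)" using T3 by simp
  then have k: "\<not> T \<subseteq> IdS (Suc k)" "k \<le> 2"
    unfolding k_def by (rule LeastI, rule Least_le)
  have Tk: "T \<subseteq> IdS k"
  proof (cases k)
    case (Suc j)
    then show ?thesis using not_less_Least[of j "\<lambda>k. \<not> T \<subseteq> IdS (Suc k)"] by (simp flip: k_def)
  qed (simp add: IdS_0)
  have nil: "nil (Suc k) \<in> T" by (rule linear_word_nil[OF T S7 _ k(1)]) simp
  have basis: "basis \<subseteq> T" by (rule basis_subset[OF S7 T T3])
  show ?thesis
  proof (cases "T \<subseteq> Id_M2")
    case True
    with Id_M2_Int_IdS_subset[OF T basis k(2) nil] Tk k(2) show ?thesis by blast
  next
    case False
    from IdS_subset[OF T basis k(2) nil squares_equal[OF T S7 False]] Tk k(2) show ?thesis by blast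
  qed
qed

theorem theorem3p16:
  shows "{T. eq_theory T \<and> Id_S7 \<subseteq> T \<and> finitely_based T}
           = {UNIV, Id_M2, Id_Sca, Id_Scab, Id_M2 \<inter> Id_Sca, Id_M2 \<inter> Id_Scab}
         \<and> card {T. eq_theory T \<and> Id_S7 \<subseteq> T \<and> finitely_based T} = 6"
proof -
  let ?F = "{T. eq_theory T \<and> Id_S7 \<subseteq> T \<and> finitely_based T}"
  let ?L = "{UNIV, Id_M2, Id_Sca, Id_Scab, Id_M2 \<inter> Id_Sca, Id_M2 \<inter> Id_Scab}"
  \<comment> \<open>\<open>k = 0\<close> accounts for \<open>UNIV\<close> and
    \<open>Id_M2\<close>.\<close>
  have L: "?L = {T. \<exists>k\<le>2. T = IdS k \<or> T = Id_M2 \<inter> IdS k}"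
  proof -
    have "k \<le> 2 \<longleftrightarrow> k = 0 \<or> k = 1 \<or> k = 2" for k :: nat by auto
    then have "{T. \<exists>k\<le>2. T = IdS k \<or> T = Id_M2 \<inter> IdS k} =
        {IdS 0, Id_M2 \<inter> IdS 0, IdS 1, IdS 2, Id_M2 \<inter> IdS 1, Id_M2 \<inter> IdS 2}"
      by auto
    then show ?thesis by (simp only: IdS_0 Id_Sca_eq Id_Scab_eq Int_UNIV_right)
  qed
  have "?F = ?L"
    unfolding L
  proof (intro equalityI subsetI; (elim CollectE exE conjE)?; (intro CollectI)?)
    fix T k
    assume "k \<le> (2::nat)" and T: "T = IdS k \<or> T = Id_M2 \<inter> IdS k"
    from T show "eq_theory T \<and> Id_S7 \<subseteq> T \<and> finitely_based T"
      using eq_theory_IdS[of k] eq_theory_Int[OF eq_theory_Id_M2 eq_theory_IdS[of k]]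
        Id_S7_subset_IdS[of k] Id_S7_subset_Id_M2 finitely_based_IdS[OF \<open>k \<le> 2\<close>]
        finitely_based_Id_M2_Int_IdS[OF \<open>k \<le> 2\<close>] by auto
  qed (rule finitely_based_cases)
  moreover have "card ?L = 6"
  proof -
    \<comment> \<open>The six theories differ in which of these three identities they
      contain.\<close>
    have N1: "nil 1 \<in> Id_M2" "nil 1 \<notin> Id_Sca" "nil 1 \<notin> Id_Scab"
      and N2: "nil 2 \<in> Id_M2" "nil 2 \<in> Id_Sca" "nil 2 \<notin> Id_Scab"
      and sq: "squares \<notin> Id_M2" "squares \<in> Id_Sca" "squares \<in> Id_Scab"
      using nil_in_Id_M2[of 1] nil_in_Id_M2[of 2] nil_not_in_IdS[of 1] nil_not_in_IdS[of 2] nil_in_IdS[of 1 2]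
        IdS_antimono[of 1 2] squares_not_in_Id_M2 squares_in_IdS
      unfolding Id_Sca_eq Id_Scab_eq by auto
    have "distinct [UNIV, Id_M2, Id_Sca, Id_Scab, Id_M2 \<inter> Id_Sca, Id_M2 \<inter> Id_Scab]"
      unfolding distinct.simps list.set insert_iff empty_iff
      using N1 N2 sq by blast
    from distinct_card[OF this] show ?thesis by simp
  qed
  ultimately show ?thesis by simp
qed

end
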